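(* In the setting of the context (a Markov chain with minorization constant $0<\bar b<1$, its split chain, and the return-time distribution $(\bar b_n)_{n\ge1}$ to the artificial atom), suppose that $\bar b_1\ge b$ and that $$\bar b(r)=\sum_{n\ge1}\bar b_nr^n\le L(r)\qquad\text{for all } 1\le r\le R \text{ with } (1-\bar b)r^{1+\alpha_1}<1 .$$ Let $\bar\alpha=\frac{\bar b^{-1}\pi(C)^{-1}-1}{1-b}$ and $$\bar r_0=\min\big\{R,\ (1-\bar b)^{-\frac1{1+\alpha_1}},\ \bar r_0(\bar\alpha)\big\},$$ where $\bar r_0(\bar\alpha)$ is the unique solution $r>1$ of $r=\big(1+\frac{D(\bar\alpha)}{\bar\alpha}\big)^{1/\bar\kappa(\bar\alpha,r)}$ (and $\bar r_0(\bar\alpha)=+\infty$ if there is no solution in the domain of $\bar\kappa(\bar\alpha,\cdot)$). Then for every $1<r<\bar r_0$ $$\sup_{|z|=r}\Big|\sum_{n=0}^\infty(\bar u_n-\bar u_\infty)z^n\Big|\le \bar K_0(r)=\frac{\bar b\,\pi(C)\,(r^{\bar\kappa(\bar\alpha,r)}-1)}{(r-1)\big(\bar\alpha^{-1}D(\bar\alpha)-r^{\bar\kappa(\bar\alpha,r)}+1\big)}.$$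
   Context: Setting. $(X_n)_{n\ge0}$ is a time-homogeneous Markov chain on $(\mathcal S,\mathcal B)$ with one-step transition probability $\mathbf P(x,\cdot)$ and unique stationary probability $\pi$; $Pf(x)=\int f(y)\mathbf P(x,dy)$. Conditions: (1) there are $C\in\mathcal B$, $\bar b\in(0,1)$ and a probability measure $\nu$ with $\mathbf P(x,A)\ge\bar b\nu(A)$ for $x\in C$, $A\in\mathcal B$; (2) there are measurable $V:\mathcal S\to[1,\infty)$, $0<\lambda<1$, $K<\infty$ with $PV\le\lambda V$ off $C$ and $PV\le K$ on $C$; (3) $\bar b\nu(C)\ge b>0$. Split chain. $(X_n,Y_n)$ on $\mathcal S\times\{0,1\}$: with $\mathcal F^X_n=\sigma(X_0,\dots,X_n)$, $\mathcal F^Y_n=\sigma(Y_0,\dots,Y_n)$, $\mathbf P(Y_n=1\mid\mathcal F^X_n,\mathcal F^Y_{n-1})=\bar b1_C(X_n)$, and given $\mathcal F^X_n,\mathcal F^Y_n$, $X_{n+1}$ has law $\nu$ if $Y_n=1$ and law $\frac{\mathbf P(X_n,\cdot)-\bar b1_C(X_n)\nu(\cdot)}{1-\bar b1_C(X_n)}$ if $Y_n=0$. $\mathbf P_{x,i}$ is the law started at $X_0=x,Y_0=i$; $\mathbf P_{a,1}$ is the same for all $a\in C$. $T=\min\{n\ge1:Y_n=1\}$, $\bar b_n=\mathbf P_{a,1}(T=n)$ (so $\bar b_1=\bar b\nu(C)$), $\bar u_n=\mathbf P_{a,1}(Y_n=1)$ (the renewal sequence of $(\bar b_n)$: $\bar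 u_0=1$, $\bar u_n=\sum_{k=1}^n\bar u_{n-k}\bar b_k$), $\bar u_\infty=\lim\bar u_n=\bar b\pi(C)=(\sum_n n\bar b_n)^{-1}$. Notation. $R=\lambda^{-1}$, $L=KR$, $$\alpha_1=\frac{\log\frac{L-\bar bR}{(1-\bar b)R}}{\log R},\qquad \alpha_2=\frac{\log\frac{L-(1-\bar b+b)R}{(\bar b-b)R}}{\log R},$$ $$L(r)=\max\Big\{\frac{\bar br}{1-(1-\bar b)r^{1+\alpha_1}},\frac{br+(\bar b-b)r^{1+\alpha_2}}{1-(1-\bar b)r}\Big\},$$ and if $1+b\ge2\bar b$ simply $L(r)=\frac{\bar br}{1-(1-\bar b)r^{1+\alpha_1}}$. For $\alpha>0$, $$D(\alpha)=\frac{|1+\frac{b}{1-b}(1-e^{\frac{i\pi}{1+\alpha}})|-1}{|1-e^{\frac{i\pi}{1+\alpha}}|}.$$ Let $J=\{x\in[0,\log R]:(1-\bar b)e^{(1+\alpha_1)x}<1\}$ and, for $\bar\alpha>0$, $F_1(x)=\log\frac{L(e^x)-e^x}{(1-b)\bar\alpha(e^x-1)}$, $x\in J\setminus\{0\}$. Let $\bar F$ be the largest (pointwise) function on $J$ that is convex, satisfies $\bar F(0)=0$ and $\bar F\le F_1$ on $J\setminus\{0\}$. Put $\bar\kappa(\bar\alpha,r)=\bar F(\log r)/\log r$ for $r>1$, $\log r\in J$. *)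

theory Defs
  imports "HOL-Probability.Probability"
begin

definition stationary :: "'a measure \<Rightarrow> ('a \<Rightarrow> 'a measure) \<Rightarrow> 'a measure \<Rightarrow> bool" where
  "stationary S P \<mu> \<longleftrightarrow> prob_space \<mu> \<and> sets \<mu> = sets S \<and>
     (\<forall>A\<in>sets S. emeasure \<mu> A = (\<integral>\<^sup>+x. emeasure (P x) A \<partial>\<mu>))"

locale drift_chain =
  fixes S :: "'a measure" and P :: "'a \<Rightarrow> 'a measure" and \<pi> :: "'a measure"
    and C :: "'a set" and bb :: real and \<nu> :: "'a measure"
    and V :: "'a \<Rightarrow> real" and lam K b :: real
  assumes kernel: "P \<in> S \<rightarrow>\<^sub>M prob_algebra S"
    and stationary_pi: "stationary S P \<pi>"
    and stationary_unique: "\<And>\<mu>. stationary S P \<mu> \<Longrightarrow> \<mu> = \<pi>"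
    and C_sets: "C \<in> sets S"
    and bb_pos: "0 < bb" and bb_less_1: "bb < 1"
    and prob_nu: "prob_space \<nu>" and sets_nu: "sets \<nu> = sets S"
    and minorization: "\<And>x A. x \<in> C \<Longrightarrow> A \<in> sets S \<Longrightarrow> bb * measure \<nu> A \<le> measure (P x) A"
    and V_measurable: "V \<in> borel_measurable S"
    and V_ge_1: "\<And>x. x \<in> space S \<Longrightarrow> 1 \<le> V x"
    and lam_pos: "0 < lam" and lam_less_1: "lam < 1"
    and drift_off_C: "\<And>x. x \<in> space S - C \<Longrightarrow> (\<integral>\<^sup>+y. ennreal (V y) \<partial>P x) \<le> ennreal (lam * V x)"
    and drift_on_C: "\<And>x. x \<in> C \<Longrightarrow> (\<integral>\<^sup>+y. ennreal (V y) \<partial>P x) \<le> ennreal K"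
    and b_pos: "0 < b" and b_le: "b \<le> bb * measure \<nu> C"

text \<open>The sigma-algebra generated by \<open>X\<^sub>i\<close> for \<open>i \<le> n\<close> and \<open>Y\<^sub>i\<close> for \<open>i < m\<close>.\<close>

definition history ::
  "'w measure \<Rightarrow> 'a measure \<Rightarrow> (nat \<Rightarrow> 'w \<Rightarrow> 'a) \<Rightarrow> (nat \<Rightarrow> 'w \<Rightarrow> nat) \<Rightarrow> nat \<Rightarrow> nat \<Rightarrow> 'w measure" where
  "history M S X Y n m = sigma (space M)
     ((\<Union>i\<in>{..n}. {X i -` A \<inter> space M |A. A \<in> sets S}) \<union>
      (\<Union>i\<in>{..<m}. {Y i -` B \<inter> space M |B. B \<subseteq> {0, 1}}))"

text \<open>
  A realisation, on a probability space \<open>M\<close>, of the split chain under \<open>P\<^sub>x\<^sub>,\<^sub>i\<close>.  Since \<open>Y\<^sub>0 = i\<close> is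
  prescribed, the conditional law of \<open>Y\<^sub>n\<close> is imposed for \<open>n \<ge> 1\<close> only.  The start in \<open>x\<close> is
  expressed by the law of \<open>X\<^sub>0\<close>, because \<open>{x}\<close> need not be measurable.
\<close>

locale split_chain = prob_space M
  for M :: "'w measure" +
  fixes S :: "'a measure" and P :: "'a \<Rightarrow> 'a measure"
    and C :: "'a set" and bb :: real and \<nu> :: "'a measure"
    and X :: "nat \<Rightarrow> 'w \<Rightarrow> 'a" and Y :: "nat \<Rightarrow> 'w \<Rightarrow> nat"
    and x :: 'a and i :: nat
  assumes X_measurable: "\<And>n. X n \<in> M \<rightarrow>\<^sub>M S"
    and Y_measurable: "\<And>n. Y n \<in> M \<rightarrow>\<^sub>M count_space {0, 1}"
    and X_0: "distr M S (X 0) = return S x"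
    and Y_0: "AE \<omega> in M. Y 0 \<omega> = i"
    and Y_law: "\<And>n. 1 \<le> n \<Longrightarrow>
      AE \<omega> in M. real_cond_exp M (history M S X Y n n) (\<lambda>\<omega>. indicator {1} (Y n \<omega>)) \<omega>
        = bb * indicator C (X n \<omega>)"
    and X_law: "\<And>n A. A \<in> sets S \<Longrightarrow>
      AE \<omega> in M. real_cond_exp M (history M S X Y n (Suc n)) (\<lambda>\<omega>. indicator A (X (Suc n) \<omega>)) \<omega>
        = (if Y n \<omega> = 1 then measure \<nu> A
           else (measure (P (X n \<omega>)) A - bb * indicator C (X n \<omega>) * measure \<nu> A)
                  / (1 - bb * indicator C (X n \<omega>)))"

definition first_return :: "(nat \<Rightarrow> 'w \<Rightarrow> nat) \<Rightarrow> 'w \<Rightarrow> enat" where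
  "first_return Y \<omega> = (INF n\<in>{n. 1 \<le> n \<and> Y n \<omega> = 1}. enat n)"

definition return_prob :: "'w measure \<Rightarrow> (nat \<Rightarrow> 'w \<Rightarrow> nat) \<Rightarrow> nat \<Rightarrow> real" where
  "return_prob M Y n = measure M {\<omega>\<in>space M. first_return Y \<omega> = enat n}"

definition renewal_prob :: "'w measure \<Rightarrow> (nat \<Rightarrow> 'w \<Rightarrow> nat) \<Rightarrow> nat \<Rightarrow> real" where
  "renewal_prob M Y n = measure M {\<omega>\<in>space M. Y n \<omega> = 1}"

text \<open>The series has nonnegative terms and may a priori diverge, hence the value in \<^typ>\<open>ennreal\<close>.\<close>

definition return_gf :: "'w measure \<Rightarrow> (nat \<Rightarrow> 'w \<Rightarrow> nat) \<Rightarrow> real \<Rightarrow> ennreal" where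
  "return_gf M Y r = (\<Sum>n. ennreal (return_prob M Y (Suc n) * r ^ Suc n))"

text \<open>
  Below, \<open>R\<close>, \<open>L\<close>, \<open>bb\<close>, \<open>b\<close> and \<open>\<alpha>\<close> are the scalar parameters, in the application
  \<open>R = 1 / lam\<close> and \<open>L = K * R\<close>.
\<close>

definition alpha1 :: "real \<Rightarrow> real \<Rightarrow> real \<Rightarrow> real" where
  "alpha1 R L bb = ln ((L - bb * R) / ((1 - bb) * R)) / ln R"

definition alpha2 :: "real \<Rightarrow> real \<Rightarrow> real \<Rightarrow> real \<Rightarrow> real" where
  "alpha2 R L bb b = ln ((L - (1 - bb + b) * R) / ((bb - b) * R)) / ln R"

definition L_bound :: "real \<Rightarrow> real \<Rightarrow> real \<Rightarrow> real \<Rightarrow> real \<Rightarrow> real" where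
  "L_bound R L bb b r =
     (if 1 + b \<ge> 2 * bb then bb * r / (1 - (1 - bb) * r powr (1 + alpha1 R L bb))
      else max (bb * r / (1 - (1 - bb) * r powr (1 + alpha1 R L bb)))
               ((b * r + (bb - b) * r powr (1 + alpha2 R L bb b)) / (1 - (1 - bb) * r)))"

definition D :: "real \<Rightarrow> real \<Rightarrow> real" where
  "D b \<alpha> = (cmod (1 + of_real (b / (1 - b)) * (1 - exp (\<i> * of_real (pi / (1 + \<alpha>))))) - 1)
           / cmod (1 - exp (\<i> * of_real (pi / (1 + \<alpha>))))"

definition J :: "real \<Rightarrow> real \<Rightarrow> real \<Rightarrow> real set" where
  "J R L bb = {x \<in> {0..ln R}. (1 - bb) * exp ((1 + alpha1 R L bb) * x) < 1}"

definition F1 :: "real \<Rightarrow> real \<Rightarrow> real \<Rightarrow> real \<Rightarrow> real \<Rightarrow> real \<Rightarrow> real" where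
  "F1 R L bb b \<alpha> x = ln ((L_bound R L bb b (exp x) - exp x) / ((1 - b) * \<alpha> * (exp x - 1)))"

definition convex_minorant ::
  "real \<Rightarrow> real \<Rightarrow> real \<Rightarrow> real \<Rightarrow> real \<Rightarrow> (real \<Rightarrow> real) \<Rightarrow> bool" where
  "convex_minorant R L bb b \<alpha> F \<longleftrightarrow>
     convex_on (J R L bb) F \<and> F 0 = 0 \<and> (\<forall>x\<in>J R L bb - {0}. F x \<le> F1 R L bb b \<alpha> x)"

text \<open>The values of the largest minorant are determined on \<^const>\<open>J\<close>; elsewhere they are irrelevant.\<close>

definition Fbar :: "real \<Rightarrow> real \<Rightarrow> real \<Rightarrow> real \<Rightarrow> real \<Rightarrow> real \<Rightarrow> real" where
  "Fbar R L bb b \<alpha> = (SOME F. convex_minorant R L bb b \<alpha> F \<and>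
     (\<forall>G. convex_minorant R L bb b \<alpha> G \<longrightarrow> (\<forall>x\<in>J R L bb. G x \<le> F x)))"

definition kappa :: "real \<Rightarrow> real \<Rightarrow> real \<Rightarrow> real \<Rightarrow> real \<Rightarrow> real \<Rightarrow> real" where
  "kappa R L bb b \<alpha> r = Fbar R L bb b \<alpha> (ln r) / ln r"

definition is_r0_solution :: "real \<Rightarrow> real \<Rightarrow> real \<Rightarrow> real \<Rightarrow> real \<Rightarrow> real \<Rightarrow> bool" where
  "is_r0_solution R L bb b \<alpha> r \<longleftrightarrow> 1 < r \<and> ln r \<in> J R L bb \<and>
     r = (1 + D b \<alpha> / \<alpha>) powr (1 / kappa R L bb b \<alpha> r)"

definition r0_alpha :: "real \<Rightarrow> real \<Rightarrow> real \<Rightarrow> real \<Rightarrow> real \<Rightarrow> ereal" where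
  "r0_alpha R L bb b \<alpha> =
     (if \<exists>r. is_r0_solution R L bb b \<alpha> r then ereal (THE r. is_r0_solution R L bb b \<alpha> r) else \<infinity>)"

definition r0_bar :: "real \<Rightarrow> real \<Rightarrow> real \<Rightarrow> real \<Rightarrow> real \<Rightarrow> ereal" where
  "r0_bar R L bb b \<alpha> =
     Min {ereal R, ereal ((1 - bb) powr (- (1 / (1 + alpha1 R L bb)))), r0_alpha R L bb b \<alpha>}"

text \<open>\<open>c\<close> stands for the stationary mass of the set \<open>C\<close>.\<close>

definition K0_bar :: "real \<Rightarrow> real \<Rightarrow> real \<Rightarrow> real \<Rightarrow> real \<Rightarrow> real \<Rightarrow> real \<Rightarrow> real" where
  "K0_bar R L bb b c \<alpha> r = bb * c * (r powr kappa R L bb b \<alpha> r - 1)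
     / ((r - 1) * (D b \<alpha> / \<alpha> - r powr kappa R L bb b \<alpha> r + 1))"

end

theory Submission
  imports Defs "HOL-Complex_Analysis.Complex_Analysis"
begin

text \<open>
  Let \<open>p\<close> be the law of the return time \<open>T\<close> to the atom, \<open>c\<^sub>n = P(T > n)\<close> its tails and
  \<open>c(z) = \<Sum>\<^sub>n c\<^sub>n z\<^sup>n\<close>.  Then \<open>(z - 1) c(z) = p(z) - 1\<close> and \<open>c(1) = E T\<close>, so the renewal equation
  \<open>u(z) = 1 / (1 - p(z))\<close> becomes
  \<open>\<Sum>\<^sub>n (u\<^sub>n - 1 / c(1)) z\<^sup>n = (c(1) - c(z)) / ((1 - z) c(z) c(1))\<close>,
  first for formal power series and then in every disc where \<open>c\<close> converges without a zero.
  The quotient \<open>(c(1) - c(z)) / (1 - z)\<close> is a power series with nonnegative coefficients, hence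
  bounded on \<open>|z| = r\<close> by its value \<open>(c(r) - c(1)) / (r - 1)\<close> at \<open>r\<close>; and moving from the unit
  circle out to radius \<open>r\<close> changes \<open>c\<close> by at most \<open>c(r) - c(1)\<close>.  Two estimates remain.

  The first is \<open>|c(w)| \<ge> (1 - b) D(\<alpha>)\<close> for \<open>|w| = 1\<close> (\<open>tail_gf_unit_circle\<close>).  Splitting off the mass
  \<open>b\<close> at time \<open>1\<close> gives \<open>1 - p(w) = (1 - b) (1 + \<beta> (1 - w) - g(w))\<close> with \<open>\<beta> = b / (1 - b)\<close> and \<open>g\<close> the
  generating function of a law with mean \<open>1 + \<alpha>\<close>.  From \<open>|g(w)| \<le> 1\<close> one gets a bound that, divided
  by \<open>|1 - w|\<close>, increases with \<open>|1 - w|\<close> and equals \<open>D(\<alpha>)\<close> at the angle \<open>\<pi> / (1 + \<alpha>)\<close>.  For a smaller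
  angle \<open>\<theta>\<close>, Markov's inequality leaves at most the fraction \<open>(1 + \<alpha>) \<theta> / \<pi>\<close> of the mass beyond half a
  turn, and only that mass can bring \<open>g(w)\<close> close to \<open>1 + \<beta> (1 - w)\<close>: the unit disc may be
  replaced by a disc that is smaller by this factor, and a rescaling yields \<open>D(\<alpha>)\<close> again
  (\<open>cis_pgf_distance\<close>).

  The second is an upper bound for \<open>c(r) - c(1)\<close>.  The function \<open>ln ((c(e\<^sup>x) - 1) / (c(1) - 1))\<close> is
  convex and vanishes at \<open>0\<close>, and the bound assumed for the generating function of \<open>p\<close> says that it
  lies below \<open>F1\<close>.  So it lies below the largest convex minorant, which means
  \<open>c(r) - c(1) \<le> (c(1) - 1) (r\<^sup>\<kappa> - 1)\<close>.  This minorant is positive off \<open>0\<close> and convex, so it crosses the level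
  \<open>ln (1 + D(\<alpha>) / \<alpha>)\<close> at most once; for \<open>r\<close> below the crossing the loss \<open>c(r) - c(1)\<close> stays smaller
  than \<open>(1 - b) D(\<alpha>)\<close>, and \<open>c\<close> has no zero up to there (\<open>Fbar_less_level\<close>,
  \<open>kendall_convex_minorant_bound\<close>).

  The chain itself enters through the renewal equation for \<open>u\<close> (\<open>renewal_equation\<close>), the finiteness of
  \<open>E T\<close>, a consequence of the drift condition (\<open>summable_unreturned\<close>), and Kac's formula
  \<open>bb \<pi>(C) E T = 1\<close>, which holds because the normalised occupation measure of one excursion is
  stationary and therefore equal to \<open>\<pi>\<close> (\<open>kac_formula\<close>).  Finally \<open>u\<^sub>n \<longlonglongrightarrow> 1 / E T\<close> follows from the
  summability at a radius \<open>r > 1\<close>.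
\<close>

section \<open>Distance between characteristic functions and a chord\<close>

text \<open>
  With \<open>s = |1 - w|\<close> on the unit circle, \<open>|1 + \<beta> (1 - w)|\<^sup>2 = 1 + \<beta> (1 + \<beta>) s\<^sup>2\<close>; so this is
  \<open>(|1 + \<beta> (1 - w)| - 1) / |1 - w|\<close> as a function of the chord length \<open>s\<close>.
\<close>
definition chord_bound :: "real \<Rightarrow> real \<Rightarrow> real" where
  "chord_bound \<beta> s = (sqrt (1 + \<beta> * (1 + \<beta>) * s\<^sup>2) - 1) / s"

lemma norm_one_minus_cis: "0 \<le> t \<Longrightarrow> t \<le> 2 * pi \<Longrightarrow> cmod (1 - cis t) = 2 * sin (t / 2)"
proof -
  assume t: "0 \<le> t" "t \<le> 2 * pi"
  have "cmod (1 - cis t) = 2 * \<bar>sin (t / 2)\<bar>"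
    using dist_exp_i_1[of t] by (simp add: norm_minus_commute cis_conv_exp mult.commute)
  moreover have "0 \<le> sin (t / 2)" using t by (intro sin_ge_zero) auto
  ultimately show ?thesis by simp
qed

lemma D_eq_chord_bound:
  assumes "0 < b" "b < 1" "0 \<le> \<alpha>"
  shows "D b \<alpha> = chord_bound (b / (1 - b)) (2 * sin (pi / (1 + \<alpha>) / 2))"
proof -
  define \<beta> where "\<beta> = b / (1 - b)"
  define t where "t = pi / (1 + \<alpha>)"
  have t: "0 \<le> t" "t \<le> 2 * pi" using assms by (auto simp: t_def field_simps)
  have e: "exp (\<i> * of_real t) = cis t" by (simp add: cis_conv_exp mult.commute)
  have s2: "(2 * sin (t / 2))\<^sup>2 = 2 * (1 - cos t)"
    using cos_double_sin[of "t / 2"] by (simp add: power2_eq_square)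
  have "(cmod (1 + of_real \<beta> * (1 - cis t)))\<^sup>2 = (1 + \<beta> * (1 - cos t))\<^sup>2 + (\<beta> * sin t)\<^sup>2"
    unfolding cmod_power2 by simp
  also have "\<dots> = 1 + \<beta> * (1 + \<beta>) * (2 * sin (t / 2))\<^sup>2"
    unfolding s2 using sin_cos_squared_add[of t] by algebra
  finally have "cmod (1 + of_real \<beta> * (1 - cis t)) = sqrt (1 + \<beta> * (1 + \<beta>) * (2 * sin (t / 2))\<^sup>2)"
    by (metis norm_ge_zero real_sqrt_unique)
  thus ?thesis unfolding D_def chord_bound_def t_def[symmetric] \<beta>_def[symmetric] e
    by (simp add: norm_one_minus_cis t)
qed

text \<open>
  Equivalently, \<open>sqrt (1 + k t\<^sup>2) - 1\<close> is a convex function of \<open>t\<close> that vanishes at \<open>0\<close>.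
\<close>
lemma sqrt_chord_scale:
  assumes "0 \<le> k" "0 \<le> \<mu>" "\<mu> \<le> 1"
  shows "sqrt (1 + k * (\<mu> * t)\<^sup>2) - 1 \<le> \<mu> * (sqrt (1 + k * t\<^sup>2) - 1)"
proof -
  define y where "y = sqrt (1 + k * t\<^sup>2)"
  have y: "1 \<le> y" "y\<^sup>2 = 1 + k * t\<^sup>2" using assms by (auto simp: y_def)
  have "\<mu> * \<mu> * (y - 1) \<le> \<mu> * (y - 1)" using assms y
    by (intro mult_right_mono) (auto simp: mult_left_le)
  hence "1 + \<mu>\<^sup>2 * (y\<^sup>2 - 1) \<le> (1 + \<mu> * (y - 1))\<^sup>2"
    by (simp add: power2_eq_square algebra_simps)
  hence "1 + k * (\<mu> * t)\<^sup>2 \<le> (1 + \<mu> * (y - 1))\<^sup>2"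
    using y by (simp add: power_mult_distrib algebra_simps)
  hence "sqrt (1 + k * (\<mu> * t)\<^sup>2) \<le> 1 + \<mu> * (y - 1)"
    using assms y by (intro real_le_lsqrt) auto
  thus ?thesis by (simp add: y_def)
qed

lemma chord_bound_mono:
  assumes "0 \<le> \<beta>" "0 < s" "s \<le> t"
  shows "chord_bound \<beta> s \<le> chord_bound \<beta> t"
  using sqrt_chord_scale[of "\<beta> * (1 + \<beta>)" "s / t" t] assms
  by (simp add: chord_bound_def field_simps)

text \<open>
  The chord length on the unit circle is at most \<open>2\<close>, and \<open>chord_bound \<beta> 2 = \<beta>\<close>.
\<close>
lemma chord_bound_le:
  assumes "0 \<le> \<beta>" "0 < s" "s \<le> 2"
  shows "chord_bound \<beta> s \<le> \<beta>"
proof -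
  have "\<beta> * (s * s) \<le> \<beta> * (2 * s)" using assms by (intro mult_left_mono mult_right_mono) auto
  hence "sqrt (1 + \<beta> * (1 + \<beta>) * s\<^sup>2) \<le> 1 + \<beta> * s"
    using assms by (intro real_le_lsqrt) (auto simp: power2_eq_square algebra_simps)
  thus ?thesis using assms by (simp add: chord_bound_def field_simps)
qed

lemma chord_bound_pos:
  assumes "0 < \<beta>" "0 < s"
  shows "0 < chord_bound \<beta> s"
  using assms by (simp add: chord_bound_def)

lemma sine_scaling:
  assumes "0 \<le> \<mu>" "\<mu> \<le> 1" "0 \<le> t" "t \<le> pi"
  shows "\<mu> * sin t \<le> sin (\<mu> * t)"
proof -
  have "concave_on {0..pi} sin" 
    by (rule f''_le0_imp_concave[where f' = cos and f'' = "\<lambda>x. - sin x"])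
       (auto intro!: derivative_eq_intros sin_ge_zero)
  from concave_onD[OF this, of \<mu> 0 t] assms show ?thesis by simp
qed

lemma unit_vector_ge:
  fixes x y :: real
  assumes "x\<^sup>2 + y\<^sup>2 = 1"
  shows "-1 \<le> x"
proof -
  have "x\<^sup>2 \<le> 1" using assms zero_le_power2[of y] by linarith
  hence "\<bar>x\<bar> \<le> 1" by (simp only: abs_square_le_1)
  thus ?thesis by linarith
qed

text \<open>
  The vector \<open>(1 - cos x, - sin x)\<close> is \<open>1 - e\<^sup>i\<^sup>x\<close>, and the lemma bounds its component in the direction
  \<open>(e1, e2)\<close>.  The last assumption confines the direction to angles \<open>\<ge> \<pi>/2 - \<theta>/2\<close>.  For
  \<open>x \<le> \<pi> - \<theta>\<close> the vector \<open>1 - e\<^sup>i\<^sup>x\<close> has angle \<open>x/2 - \<pi>/2\<close>, which makes an obtuse or right angle with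
  every such direction; for larger \<open>x\<close> the factor \<open>(x + \<theta>) / \<pi>\<close> exceeds \<open>1\<close>.  Averaged over
  a law of \<open>x\<close>, the first bound is Markov's inequality for the mass beyond half a turn.
\<close>
lemma separating_direction_bound:
  assumes "0 \<le> \<theta>" "\<theta> \<le> pi" "0 \<le> x" 
    and e: "e1\<^sup>2 + e2\<^sup>2 = 1" "0 \<le> e2" "e1 * cos (\<theta> / 2) \<le> e2 * sin (\<theta> / 2)"
  shows "e1 * (1 - cos x) - e2 * sin x \<le> (1 + e1) * ((x + \<theta>) / pi)"
    and "e1 * (1 - cos x) - e2 * sin x \<le> 1 + e1"
proof -
  have e1: "-1 \<le> e1" by (rule unit_vector_ge[OF e(1)])
  have "(- e1 * cos x - e2 * sin x)\<^sup>2 + (e1 * sin x - e2 * cos x)\<^sup>2 = 1"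
    using e(1) sin_cos_squared_add[of x] by algebra
  hence "(- e1 * cos x - e2 * sin x)\<^sup>2 \<le> 1"
    by (metis le_add_same_cancel1 zero_le_power2)
  hence "\<bar>- e1 * cos x - e2 * sin x\<bar> \<le> 1" by (simp only: abs_square_le_1)
  hence "- e1 * cos x - e2 * sin x \<le> 1" by linarith
  thus g: "e1 * (1 - cos x) - e2 * sin x \<le> 1 + e1" by (simp add: algebra_simps)
  show "e1 * (1 - cos x) - e2 * sin x \<le> (1 + e1) * ((x + \<theta>) / pi)"
  proof (cases "x \<le> pi - \<theta>")
    case True
    have sx: "0 \<le> sin (x / 2)" using assms True by (intro sin_ge_zero) auto
    have "x / 2 \<le> pi / 2 - \<theta> / 2" using True by (simp add: field_simps)
    hence c: "sin (\<theta> / 2) \<le> cos (x / 2)" 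
      using assms cos_mono_le_eq[of "pi / 2 - \<theta> / 2" "x / 2"] by (simp add: cos_diff)
    have s: "sin (x / 2) \<le> cos (\<theta> / 2)" 
      using assms True sin_mono_le_eq[of "x / 2" "pi / 2 - \<theta> / 2"] \<open>x / 2 \<le> pi / 2 - \<theta> / 2\<close>
      by (simp add: sin_diff)
    have "0 \<le> cos (x / 2)" using assms True by (intro cos_ge_zero) auto
    have "e1 * sin (x / 2) \<le> e2 * cos (x / 2)"
    proof (cases "e1 \<le> 0")
      case True
      thus ?thesis using sx e(2) \<open>0 \<le> cos (x / 2)\<close>
        by (meson mult_nonneg_nonneg mult_nonpos_nonneg order_trans)
    next
      case False
      hence "e1 * sin (x / 2) \<le> e1 * cos (\<theta> / 2)" using s by (simp add: mult_left_mono)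
      also have "\<dots> \<le> e2 * sin (\<theta> / 2)" by (rule e)
      also have "\<dots> \<le> e2 * cos (x / 2)" using c e(2) by (simp add: mult_left_mono)
      finally show ?thesis .
    qed
    hence "2 * sin (x / 2) * (e1 * sin (x / 2) - e2 * cos (x / 2)) \<le> 0"
      using sx by (intro mult_nonneg_nonpos) auto
    also have "2 * sin (x / 2) * (e1 * sin (x / 2) - e2 * cos (x / 2)) = e1 * (1 - cos x) - e2 * sin x"
    proof -
      have "cos x = 1 - 2 * sin (x / 2) * sin (x / 2)" "sin x = 2 * sin (x / 2) * cos (x / 2)"
        using cos_double_sin[of "x / 2"] sin_double[of "x / 2"] by (auto simp: power2_eq_square)
      thus ?thesis by (simp only:) (simp add: algebra_simps)
    qed
    also have "0 \<le> (1 + e1) * ((x + \<theta>) / pi)" using e1 assms by simp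
    finally show ?thesis .
  next
    case False
    hence "1 \<le> (x + \<theta>) / pi" by (simp add: field_simps)
    hence "(1 + e1) * 1 \<le> (1 + e1) * ((x + \<theta>) / pi)" using e1 by (intro mult_left_mono) auto
    with g show ?thesis by (simp only: mult_1_right)
  qed
qed

lemma planar_projection_le:
  fixes x y e1 e2 :: real
  assumes "e1\<^sup>2 + e2\<^sup>2 = 1"
  shows "e1 * x + e2 * y \<le> sqrt (x\<^sup>2 + y\<^sup>2)"
proof -
  have "(e1 * x + e2 * y)\<^sup>2 + (e1 * y - e2 * x)\<^sup>2 = x\<^sup>2 + y\<^sup>2"
    using assms by algebra
  hence "(e1 * x + e2 * y)\<^sup>2 \<le> x\<^sup>2 + y\<^sup>2"
    by (metis le_add_same_cancel1 zero_le_power2)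
  thus ?thesis by (rule real_le_rsqrt)
qed

text \<open>
  In the application \<open>q\<close> is what remains of the law of the return time less one when the mass \<open>b\<close> at
  time \<open>1\<close> is removed.
  After multiplication by \<open>cis (- \<theta>)\<close> the distance on the right is the distance between the points
  \<open>(1 + \<beta>) s (sin (\<theta>/2), cos (\<theta>/2))\<close> and \<open>(A, B)\<close>, where \<open>A\<close> and \<open>B\<close> are the \<open>q\<close>-averages of
  \<open>1 - cos n\<theta>\<close> and \<open>- sin n\<theta>\<close>.  Seen from the first point, \<open>(A, B)\<close> lies behind the tangent to the disc of
  radius \<open>p\<close> about \<open>(p, 0)\<close>, so the distance is at least that to the disc.  The proportion \<open>s / p\<close>
  is at least the chord \<open>s0\<close> of the angle \<open>\<pi> / (1 + \<alpha>)\<close>, because sine is increasing and concave up to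
  \<open>\<pi>/2\<close>.
\<close>
lemma cis_pgf_distance:
  fixes q :: "nat \<Rightarrow> real"
  assumes q: "\<And>n. 0 \<le> q n" "q sums 1" "(\<lambda>n. real n * q n) sums \<alpha>"
    and \<beta>: "0 \<le> \<beta>" and \<theta>: "0 < \<theta>" "\<theta> \<le> pi"
  shows "chord_bound \<beta> (2 * sin (pi / (1 + \<alpha>) / 2)) * cmod (1 - cis \<theta>)
           \<le> cmod (1 + of_real \<beta> * (1 - cis \<theta>) - cis \<theta> * (\<Sum>n. of_real (q n) * cis \<theta> ^ n))"
proof -
  define s where "s = 2 * sin (\<theta> / 2)"
  define t where "t = pi / (1 + \<alpha>)"
  define s0 where "s0 = 2 * sin (t / 2)"
  define p where "p = min 1 ((1 + \<alpha>) * \<theta> / pi)"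
  have \<alpha>: "0 \<le> \<alpha>" using q(1) by (intro sums_le[OF _ sums_zero q(3)]) auto
  have p: "0 < p" "p \<le> 1" using \<alpha> \<theta> by (auto simp: p_def)
  have s: "0 < s" unfolding s_def using \<theta> by (auto intro!: sin_gt_zero)
  have "pi * 1 \<le> pi * (1 + \<alpha>)" using \<alpha> by (intro mult_left_mono) auto
  hence t0: "0 < t" "t \<le> pi" using \<alpha> by (auto simp: t_def divide_le_eq)
  have s0: "0 < s0" unfolding s0_def using sin_gt_zero[of "t / 2"] t0 pi_gt_zero by linarith
  have ps0: "s0 \<le> s / p"
  proof (cases "1 \<le> (1 + \<alpha>) * \<theta> / pi")
    case True
    hence "t \<le> \<theta>" using \<alpha> by (simp add: t_def field_simps)
    hence "sin (t / 2) \<le> sin (\<theta> / 2)"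
      using \<theta> t0 by (intro sin_mono_le_eq[THEN iffD2]) auto
    thus ?thesis using True by (simp add: s0_def s_def p_def)
  next
    case False
    hence pp: "p = (1 + \<alpha>) * \<theta> / pi" by (simp add: p_def)
    have "p * sin (t / 2) \<le> sin (p * (t / 2))"
      using p t0 pi_gt_zero by (intro sine_scaling) linarith+
    also have "p * (t / 2) = \<theta> / 2"
    proof -
      have "1 + \<alpha> \<noteq> 0" using \<alpha> by simp
      hence "p * t = \<theta>" by (simp add: pp t_def)
      thus ?thesis by simp
    qed
    finally show ?thesis using p by (simp add: s0_def s_def field_simps)
  qed
  \<comment> \<open>The vector \<open>(q1, q2)\<close> leads from the centre \<open>(p, 0)\<close> of the disc to the target point.\<close>
  define q1 where "q1 = (1 + \<beta>) * s * sin (\<theta> / 2) - p"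
  define q2 where "q2 = (1 + \<beta>) * s * cos (\<theta> / 2)"
  define \<rho> where "\<rho> = sqrt (q1\<^sup>2 + q2\<^sup>2)"
  have sh: "sin (\<theta> / 2) = s / 2" by (simp add: s_def)
  have sc: "(cos (\<theta> / 2))\<^sup>2 = 1 - s\<^sup>2 / 4" using sin_cos_squared_add[of "\<theta> / 2"] by (simp add: sh field_simps power2_eq_square)
  have "q1\<^sup>2 + q2\<^sup>2 = p\<^sup>2 + (1 + \<beta>) * (1 + \<beta> - p) * s\<^sup>2"
    unfolding q1_def q2_def power_mult_distrib sc sh by (simp add: power2_eq_square field_simps)
  moreover have "(1 + \<beta>) * \<beta> * s\<^sup>2 \<le> (1 + \<beta>) * (1 + \<beta> - p) * s\<^sup>2"
    using p \<beta> by (intro mult_right_mono mult_left_mono) auto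
  ultimately have rr: "p\<^sup>2 + \<beta> * (1 + \<beta>) * s\<^sup>2 \<le> q1\<^sup>2 + q2\<^sup>2" by (simp add: mult.commute)
  have "0 < p\<^sup>2" using p by simp
  moreover have "0 \<le> \<beta> * (1 + \<beta>) * s\<^sup>2" using \<beta> by simp
  ultimately have rpos: "0 < q1\<^sup>2 + q2\<^sup>2" using rr by linarith
  hence \<rho>: "0 < \<rho>" "\<rho>\<^sup>2 = q1\<^sup>2 + q2\<^sup>2" by (auto simp: \<rho>_def)
  have key: "s * chord_bound \<beta> s0 \<le> \<rho> - p"
  proof -
    have "chord_bound \<beta> s0 \<le> chord_bound \<beta> (s / p)"
      using \<beta> s0 ps0 by (intro chord_bound_mono)
    hence "s * chord_bound \<beta> s0 \<le> s * chord_bound \<beta> (s / p)" using s by simp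
    also have "\<dots> = p * sqrt (1 + \<beta> * (1 + \<beta>) * (s / p)\<^sup>2) - p"
      using s p by (simp add: chord_bound_def field_simps)
    also have "p * sqrt (1 + \<beta> * (1 + \<beta>) * (s / p)\<^sup>2) = sqrt (p\<^sup>2 * (1 + \<beta> * (1 + \<beta>) * (s / p)\<^sup>2))"
      using p by (simp add: real_sqrt_mult)
    also have "p\<^sup>2 * (1 + \<beta> * (1 + \<beta>) * (s / p)\<^sup>2) = p\<^sup>2 + \<beta> * (1 + \<beta>) * s\<^sup>2"
      using p by (simp add: field_simps power2_eq_square)
    also have "sqrt \<dots> \<le> \<rho>" unfolding \<rho>_def using rr by simp
    finally show ?thesis by simp
  qed
  define e1 where "e1 = q1 / \<rho>"
  define e2 where "e2 = q2 / \<rho>"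
  have e: "e1\<^sup>2 + e2\<^sup>2 = 1"
    unfolding e1_def e2_def power_divide add_divide_distrib[symmetric] \<rho>(2)[symmetric]
    using \<rho>(1) by simp
  have e1: "0 \<le> 1 + e1"
    using unit_vector_ge[OF e] by simp
  have cpos: "0 \<le> cos (\<theta> / 2)" using \<theta> by (intro cos_ge_zero) auto
  have e2: "0 \<le> e2" unfolding e2_def q2_def using \<rho> \<beta> s cpos by simp
  have "q1 * cos (\<theta> / 2) \<le> q2 * sin (\<theta> / 2)"
    using p cpos unfolding q1_def q2_def by (simp add: algebra_simps)
  hence e12: "e1 * cos (\<theta> / 2) \<le> e2 * sin (\<theta> / 2)"
    using \<rho> by (simp add: e1_def e2_def divide_right_mono)
  have sq: "summable (\<lambda>n. q n)" using q by (simp add: sums_iff)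
  have sumc: "summable (\<lambda>n. q n * cos (real n * \<theta>))" and sums': "summable (\<lambda>n. q n * sin (real n * \<theta>))"
    by (rule summable_comparison_test'[OF sq, of 0]; simp add: abs_mult q(1) mult_left_le)+
  define A where "A = 1 - (\<Sum>n. q n * cos (real n * \<theta>))"
  define B where "B = - (\<Sum>n. q n * sin (real n * \<theta>))"
  have re: "Re (cis \<theta> ^ n) = cos (real n * \<theta>)" and im: "Im (cis \<theta> ^ n) = sin (real n * \<theta>)" for n
    by (simp_all only: cos_n_Re_cis_pow_n sin_n_Im_cis_pow_n)
  have "(\<lambda>n. of_real (q n) * cis \<theta> ^ n) sums Complex (1 - A) (- B)"
    unfolding sums_complex_iff using sumc sums' 
    by (simp add: A_def B_def summable_sums re im)
  hence H: "(\<Sum>n. of_real (q n) * cis \<theta> ^ n) = Complex (1 - A) (- B)" by (simp add: sums_iff)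
  have AB: "(\<lambda>n. q n * (e1 * (1 - cos (real n * \<theta>)) - e2 * sin (real n * \<theta>))) sums (e1 * A + e2 * B)"
  proof -
    have "(\<lambda>n. e1 * (q n - q n * cos (real n * \<theta>)) - e2 * (q n * sin (real n * \<theta>))) 
          sums (e1 * (1 - (\<Sum>n. q n * cos (real n * \<theta>))) - e2 * (\<Sum>n. q n * sin (real n * \<theta>)))"
      by (intro sums_diff sums_mult q summable_sums sumc sums')
    thus ?thesis by (simp add: A_def B_def algebra_simps)
  qed
  \<comment> \<open>Both bounds on the component of \<open>(A, B)\<close> are averaged; \<open>p\<close> is the minimum of the two results.\<close>
  have "e1 * A + e2 * B \<le> 1 * (1 + e1)"
  proof (rule sums_le[OF _ AB sums_mult2[OF q(2)]])
    show "q n * (e1 * (1 - cos (real n * \<theta>)) - e2 * sin (real n * \<theta>)) \<le> q n * (1 + e1)" for n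
      using separating_direction_bound(2)[of \<theta> "real n * \<theta>" e1 e2] \<theta> e e2 e12 q(1) by (intro mult_left_mono) auto
  qed
  moreover have "e1 * A + e2 * B \<le> (1 + e1) * ((1 + \<alpha>) * \<theta> / pi)"
  proof (rule sums_le[OF _ AB])
    show "q n * (e1 * (1 - cos (real n * \<theta>)) - e2 * sin (real n * \<theta>))
            \<le> (1 + e1) * ((q n + real n * q n) * \<theta> / pi)" for n
    proof -
      have "q n * (e1 * (1 - cos (real n * \<theta>)) - e2 * sin (real n * \<theta>)) 
              \<le> q n * ((1 + e1) * ((real n * \<theta> + \<theta>) / pi))"
        using separating_direction_bound(1)[of \<theta> "real n * \<theta>" e1 e2] \<theta> e e2 e12 q(1) by (intro mult_left_mono) auto
      thus ?thesis by (simp add: algebra_simps)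
    qed
    show "(\<lambda>n. (1 + e1) * ((q n + real n * q n) * \<theta> / pi)) sums ((1 + e1) * ((1 + \<alpha>) * \<theta> / pi))"
      by (intro sums_mult sums_divide sums_mult2 sums_add q)
  qed
  ultimately have ABp: "e1 * A + e2 * B \<le> (1 + e1) * p"
    using e1 by (auto simp: p_def min_def)
  \<comment> \<open>Rotating by \<open>- \<theta>\<close> turns the quantity to be bounded into a difference of the two plane points.\<close>
  define W where "W = 1 + of_real \<beta> * (1 - cis \<theta>) - cis \<theta> * Complex (1 - A) (- B)"
  have ct: "cos \<theta> = 1 - s\<^sup>2 / 2" "sin \<theta> = s * cos (\<theta> / 2)"
    using cos_double_sin[of "\<theta> / 2"] sin_double[of "\<theta> / 2"] by (auto simp: sh power2_eq_square)
  have "cis (- \<theta>) * W = of_real (1 + \<beta>) * (cis (- \<theta>) - 1)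
          + (1 - cis (- \<theta>) * cis \<theta> * Complex (1 - A) (- B)) 
          + of_real \<beta> * (1 - cis (- \<theta>) * cis \<theta>)"
    unfolding W_def by (simp add: algebra_simps)
  also have "\<dots> = Complex (A - (q1 + p)) (B - q2)"
    by (simp add: cis_mult complex_eq_iff q1_def q2_def ct sh power2_eq_square algebra_simps)
  finally have "cis (- \<theta>) * W = Complex (A - (q1 + p)) (B - q2)" .
  hence "cmod W = sqrt ((q1 + p - A)\<^sup>2 + (q2 - B)\<^sup>2)"
    by (metis cmod_def complex.sel norm_cis norm_mult mult_1 power2_commute)
  hence "e1 * (q1 + p - A) + e2 * (q2 - B) \<le> cmod W"
    using planar_projection_le[OF e] by metis
  moreover have "e1 * q1 + e2 * q2 = \<rho>"
  proof -
    have "e1 * q1 + e2 * q2 = (q1\<^sup>2 + q2\<^sup>2) / \<rho>"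
      by (simp add: e1_def e2_def power2_eq_square add_divide_distrib)
    thus ?thesis unfolding \<rho>(2)[symmetric] by (simp add: power2_eq_square)
  qed
  ultimately have "\<rho> - p \<le> cmod W" using ABp by (simp add: algebra_simps)
  moreover have "cmod (1 - cis \<theta>) = s" using norm_one_minus_cis[of \<theta>] \<theta> by (simp add: s_def)
  ultimately show ?thesis
    using key unfolding t_def[symmetric] s0_def[symmetric] H W_def[symmetric] by (simp add: mult.commute)
qed

section \<open>Tails of a renewal distribution\<close>

text \<open>
  Laws on the positive integers with an exponential moment.  The radius \<open>\<rho>\<close> only witnesses that
  moment, so the same law can be viewed in this locale at several radii, with the same tails and the
  same mean.
\<close>
locale renewal_law =
  fixes p :: "nat \<Rightarrow> real" and \<rho> :: real
  assumes p_0: "p 0 = 0" and p_nonneg: "0 \<le> p n" and p_sums: "p sums 1"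
    and \<rho>_gt_1: "1 < \<rho>" and p_moment: "summable (\<lambda>n. p n * \<rho> ^ n)"
begin

definition tail :: "nat \<Rightarrow> real" where "tail n = 1 - (\<Sum>k\<le>n. p k)"

definition mean :: real where "mean = (\<Sum>n. tail n)"

definition pgf :: "'a::{real_normed_field, banach} \<Rightarrow> 'a" where
  "pgf z = (\<Sum>n. of_real (p n) * z ^ n)"

definition tail_gf :: "'a::{real_normed_field, banach} \<Rightarrow> 'a" where
  "tail_gf z = (\<Sum>n. of_real (tail n) * z ^ n)"

lemma tail_0: "tail 0 = 1" by (simp add: tail_def p_0)

lemma tail_Suc: "tail n = tail (Suc n) + p (Suc n)" by (simp add: tail_def)

lemma p_summable: "summable p" using p_sums by (simp add: sums_iff)

lemma tail_nonneg: "0 \<le> tail n"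
proof -
  have "(\<Sum>k\<le>n. p k) \<le> 1"
    using sum_le_suminf[OF p_summable, of "{..n}"] p_nonneg p_sums by (auto simp: sums_iff)
  thus ?thesis by (simp add: tail_def)
qed

lemma tail_eq_suminf: "tail n = (\<Sum>k. p (k + Suc n))"
  using suminf_minus_initial_segment[OF p_summable, of "Suc n"] p_sums
  by (simp add: tail_def sums_iff lessThan_Suc_atMost)

text \<open>
  The moment of order \<open>\<rho>\<close> restricted to \<open>{n<..}\<close> dominates \<open>tail n * \<rho> ^ n\<close> and tends to \<open>0\<close>.  This
  makes the boundary term of the summation by parts vanish even at radius \<open>\<rho>\<close> itself.
\<close>
lemma tail_power_tendsto_0: "(\<lambda>n. tail n * \<rho> ^ n) \<longlonglongrightarrow> 0"
proof (rule tendsto_sandwich)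
  show "\<forall>\<^sub>F n in sequentially. 0 \<le> tail n * \<rho> ^ n" using tail_nonneg \<rho>_gt_1 by simp
  have le: "tail n * \<rho> ^ n \<le> (\<Sum>k. p (k + Suc n) * \<rho> ^ (k + Suc n))" for n
  proof -
    have "tail n * \<rho> ^ n = (\<Sum>k. p (k + Suc n) * \<rho> ^ n)"
      unfolding tail_eq_suminf using p_summable
      by (subst suminf_mult2) (auto simp only: summable_iff_shift)
    also have "\<dots> \<le> (\<Sum>k. p (k + Suc n) * \<rho> ^ (k + Suc n))"
    proof (rule suminf_le)
      show "p (k + Suc n) * \<rho> ^ n \<le> p (k + Suc n) * \<rho> ^ (k + Suc n)" for k
        using \<rho>_gt_1 p_nonneg by (intro mult_left_mono power_increasing) auto
      show "summable (\<lambda>k. p (k + Suc n) * \<rho> ^ n)"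
        using p_summable by (intro summable_mult2) (simp only: summable_iff_shift)
      show "summable (\<lambda>k. p (k + Suc n) * \<rho> ^ (k + Suc n))"
        using p_moment by (rule summable_ignore_initial_segment)
    qed
    finally show ?thesis .
  qed
  thus "\<forall>\<^sub>F n in sequentially. tail n * \<rho> ^ n \<le> (\<Sum>k. p (k + Suc n) * \<rho> ^ (k + Suc n))"
    by (intro always_eventually allI le)
  show "(\<lambda>n. \<Sum>k. p (k + Suc n) * \<rho> ^ (k + Suc n)) \<longlonglongrightarrow> 0"
    by (rule LIMSEQ_Suc[OF suminf_exist_split2[OF p_moment]])
qed simp

lemma pgf_summable:
  fixes z :: "'a::{real_normed_field, banach}"
  assumes "norm z \<le> \<rho>"
  shows "summable (\<lambda>n. of_real (p n) * z ^ n)"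
  by (rule summable_comparison_test'[OF p_moment, of 0])
     (use assms p_nonneg in \<open>auto simp: norm_mult norm_power intro!: mult_left_mono power_mono\<close>)

lemma tail_summation_by_parts:
  fixes z :: "'a::{real_normed_field, banach}"
  shows "(z - 1) * (\<Sum>n<N. of_real (tail n) * z ^ n)
           = (\<Sum>n\<le>N. of_real (p n) * z ^ n) + of_real (tail N) * z ^ N - 1"
proof (induction N)
  case (Suc N)
  have "(z - 1) * (\<Sum>n<Suc N. of_real (tail n) * z ^ n) 
    = (\<Sum>n\<le>N. of_real (p n) * z ^ n) + of_real (tail N) * z ^ Suc N - 1"
    using Suc by (simp add: algebra_simps)
  also have "of_real (tail N) * z ^ Suc N = of_real (tail (Suc N)) * z ^ Suc N + of_real (p (Suc N)) * z ^ Suc N"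
    by (subst tail_Suc) (simp add: algebra_simps)
  finally show ?case by (simp add: algebra_simps)
qed (simp add: p_0 tail_0)

lemma tail_gf_sums:
  fixes z :: "'a::{real_normed_field, banach}"
  assumes z: "norm z \<le> \<rho>" and "z \<noteq> 1"
  shows "(\<lambda>n. of_real (tail n) * z ^ n) sums ((pgf z - 1) / (z - 1))"
proof -
  have "(\<lambda>N. of_real (tail N) * z ^ N) \<longlonglongrightarrow> 0"
  proof (rule Lim_null_comparison[OF _ tail_power_tendsto_0])
    show "\<forall>\<^sub>F n in sequentially. norm (of_real (tail n) * z ^ n) \<le> tail n * \<rho> ^ n"
      using z tail_nonneg by (intro always_eventually) 
        (auto simp: norm_mult norm_power intro!: mult_left_mono power_mono)
  qed
  moreover have "(\<lambda>N. \<Sum>n\<le>N. of_real (p n) * z ^ n) \<longlonglongrightarrow> pgf z"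
    using pgf_summable[OF z] unfolding pgf_def by (simp add: summable_LIMSEQ')
  ultimately have "(\<lambda>N. (\<Sum>n\<le>N. of_real (p n) * z ^ n) + of_real (tail N) * z ^ N - 1) \<longlonglongrightarrow> pgf z + 0 - 1"
    by (intro tendsto_intros)
  hence "(\<lambda>N. (z - 1) * (\<Sum>n<N. of_real (tail n) * z ^ n)) \<longlonglongrightarrow> pgf z + 0 - 1"
    by (simp only: tail_summation_by_parts)
  hence "(\<lambda>N. (z - 1) * (\<Sum>n<N. of_real (tail n) * z ^ n) / (z - 1)) \<longlonglongrightarrow> (pgf z + 0 - 1) / (z - 1)"
    using \<open>z \<noteq> 1\<close> by (intro tendsto_divide tendsto_const) auto
  thus ?thesis using \<open>z \<noteq> 1\<close> by (simp add: sums_def)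
qed

lemma tail_gf_eq:
  fixes z :: "'a::{real_normed_field, banach}"
  assumes "norm z \<le> \<rho>" "z \<noteq> 1"
  shows "tail_gf z = (pgf z - 1) / (z - 1)"
  using tail_gf_sums[OF assms] by (simp add: tail_gf_def sums_iff)

lemma tail_gf_summable_real: "0 \<le> x \<Longrightarrow> x \<le> \<rho> \<Longrightarrow> summable (\<lambda>n. tail n * x ^ n)"
proof -
  assume x: "0 \<le> x" "x \<le> \<rho>"
  have "summable (\<lambda>n. tail n * \<rho> ^ n)"
    using tail_gf_sums[of \<rho>] \<rho>_gt_1 by (simp add: sums_iff)
  thus ?thesis
    by (rule summable_comparison_test'[where N = 0]) 
       (use x tail_nonneg in \<open>auto simp: abs_mult power_abs intro!: mult_left_mono power_mono\<close>)
qed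

lemma tail_gf_summable:
  fixes z :: "'a::{real_normed_field, banach}"
  assumes "norm z \<le> \<rho>"
  shows "summable (\<lambda>n. of_real (tail n) * z ^ n)"
  by (rule summable_comparison_test'[OF tail_gf_summable_real[of "norm z"], of 0])
     (use assms tail_nonneg in \<open>auto simp: norm_mult norm_power\<close>)

lemma tail_sums_mean: "tail sums mean"
  using tail_gf_summable_real[of 1] \<rho>_gt_1 by (simp add: mean_def sums_iff)

lemma tail_gf_1: "tail_gf 1 = of_real mean"
  using tail_sums_mean by (simp add: tail_gf_def sums_iff mean_def suminf_of_real)

lemma mean_ge_1: "1 \<le> mean"
  using sum_le_suminf[of tail "{0}"] tail_sums_mean tail_nonneg by (simp add: sums_iff tail_0)

lemma first_moment_sums: "(\<lambda>n. real n * p n) sums mean"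
proof -
  have *: "(\<Sum>n<N. tail n) = (\<Sum>n\<le>N. real n * p n) + real N * tail N" for N
  proof (induction N)
    case (Suc N)
    thus ?case by (simp add: tail_Suc[of N] algebra_simps)
  qed simp
  have "(\<lambda>N. (real N / \<rho> ^ N) * (tail N * \<rho> ^ N)) \<longlonglongrightarrow> 0 * 0"
    using \<rho>_gt_1 by (intro tendsto_mult tail_power_tendsto_0 lim_n_over_pown) auto
  hence "(\<lambda>N. real N * tail N) \<longlonglongrightarrow> 0" using \<rho>_gt_1 by simp
  from tendsto_diff[OF tail_sums_mean[unfolded sums_def] this]
  show ?thesis unfolding sums_def_le * by simp
qed

text \<open>
  As \<open>p 0 = 0\<close>, every term carries at least one factor \<open>z\<close>.
\<close>
lemma pgf_norm_less_1:
  fixes z :: "'a::{real_normed_field, banach}"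
  assumes "norm z < 1"
  shows "norm (pgf z) < 1"
proof -
  have "norm (pgf z) \<le> (\<Sum>n. p n * norm z)" unfolding pgf_def
  proof (rule norm_suminf_le)
    show "norm (of_real (p n) * z ^ n) \<le> p n * norm z" for n
    proof (cases n)
      case (Suc k)
      have "norm z ^ Suc k \<le> norm z ^ 1" using assms by (intro power_decreasing) auto
      thus ?thesis using Suc p_nonneg by (simp add: norm_mult norm_power mult_left_mono)
    qed (simp add: p_0)
  qed (use p_summable in \<open>intro summable_mult2\<close>)
  also have "\<dots> = norm z" using p_sums p_summable by (simp add: suminf_mult2[symmetric] sums_iff)
  finally show ?thesis using assms by simp
qed

lemma tail_gf_nonzero_disc:
  fixes z :: "'a::{real_normed_field, banach}"
  assumes "norm z < 1"
  shows "tail_gf z \<noteq> 0"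
proof -
  have "pgf z \<noteq> 1" "z \<noteq> 1" using pgf_norm_less_1[OF assms] assms by auto
  thus ?thesis using assms \<rho>_gt_1 by (simp add: tail_gf_eq)
qed

text \<open>
  Along a ray the coefficients gain the nonnegative factors \<open>r ^ n - 1\<close>, so the growth is largest
  on the positive real axis.
\<close>
lemma tail_gf_radial_diff_le:
  fixes z w :: complex
  assumes r: "1 \<le> r" "r \<le> \<rho>" and w: "cmod w = 1" and z: "z = of_real r * w"
  shows "cmod (tail_gf z - tail_gf w) \<le> tail_gf r - mean"
proof -
  have nz: "cmod z = r" using r w z by (simp add: norm_mult)
  have "tail_gf z - tail_gf w = (\<Sum>n. of_real (tail n) * z ^ n - of_real (tail n) * w ^ n)"
    unfolding tail_gf_def using r w nz by (intro suminf_diff tail_gf_summable) auto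
  also have "cmod \<dots> \<le> (\<Sum>n. tail n * r ^ n - tail n)"
  proof (rule norm_suminf_le)
    show "cmod (of_real (tail n) * z ^ n - of_real (tail n) * w ^ n) \<le> tail n * r ^ n - tail n" for n
    proof -
      have "of_real (tail n) * z ^ n - of_real (tail n) * w ^ n = of_real (tail n * r ^ n - tail n) * w ^ n"
        by (simp add: z power_mult_distrib algebra_simps)
      also have "cmod \<dots> = \<bar>tail n * r ^ n - tail n\<bar>" using w 
        by (simp only: norm_mult norm_power norm_of_real) simp
      also have "\<dots> = tail n * r ^ n - tail n"
        using r tail_nonneg[of n] by (simp add: mult_le_cancel_left1)
      finally show ?thesis by simp
    qed
    show "summable (\<lambda>n. tail n * r ^ n - tail n)"
      using r tail_gf_summable_real[of r] tail_sums_mean by (intro summable_diff) (auto simp: sums_iff)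
  qed
  also have "\<dots> = tail_gf r - mean"
    unfolding tail_gf_def mean_def using r tail_gf_summable_real[of r] tail_sums_mean
    by (subst suminf_diff[symmetric]) (auto simp: sums_iff)
  finally show ?thesis .
qed

lemma tail_gf_strict_mono:
  assumes xy: "0 \<le> x" "x < y" "y \<le> \<rho>" and "p 1 < 1"
  shows "(tail_gf x :: real) < tail_gf y"
proof -
  have t1: "0 < tail 1" using \<open>p 1 < 1\<close> by (simp add: tail_def p_0)
  have s: "summable (\<lambda>n. tail n * y ^ n)" "summable (\<lambda>n. tail n * x ^ n)"
    using xy by (auto intro!: tail_gf_summable_real)
  have "0 < (\<Sum>n. tail n * y ^ n - tail n * x ^ n)"
  proof (rule suminf_pos2[where i = 1])
    show "0 \<le> tail n * y ^ n - tail n * x ^ n" for n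
      using xy tail_nonneg by (simp add: mult_left_mono power_mono)
  qed (use t1 xy s in \<open>auto intro: summable_diff\<close>)
  also have "\<dots> = tail_gf y - tail_gf x"
    using suminf_diff[OF s] by (simp add: tail_gf_def)
  finally show ?thesis by simp
qed

text \<open>
  The tails \<open>tail 1, tail 2, \<dots>\<close>, normalised to total mass one, form a law of the same kind.  The
  generating function of its tails is the difference quotient
  \<open>(tail_gf z - mean) / ((mean - 1) (z - 1))\<close>, so the facts proved for one law apply to the
  numerator in Kendall's theorem as well.
\<close>
lemma normalized_tail_law:
  assumes "p 1 < 1"
  shows "renewal_law (\<lambda>n. if n = 0 then 0 else tail n / (mean - 1)) \<rho>"
    and "1 < mean"
proof -
  have "tail 0 + tail 1 \<le> mean"
    using sum_le_suminf[of tail "{0, 1}"] tail_sums_mean tail_nonneg by (simp add: sums_iff)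
  thus m: "1 < mean" using assms by (simp add: tail_0) (simp add: tail_def p_0)
  show "renewal_law (\<lambda>n. if n = 0 then 0 else tail n / (mean - 1)) \<rho>"
  proof
    have "(\<lambda>n. (tail n - (if n = 0 then 1 else 0)) / (mean - 1)) sums ((mean - 1) / (mean - 1))"
      by (intro sums_divide sums_diff tail_sums_mean sums_single)
    also have "(\<lambda>n. (tail n - (if n = 0 then 1 else 0)) / (mean - 1))
            = (\<lambda>n. if n = 0 then 0 else tail n / (mean - 1))" by (auto simp: tail_0)
    finally show "(\<lambda>n. if n = 0 then 0 else tail n / (mean - 1)) sums 1" using m by simp
    show "summable (\<lambda>n. (if n = 0 then 0 else tail n / (mean - 1)) * \<rho> ^ n)"
    proof (rule summable_comparison_test')
      show "summable (\<lambda>n. tail n * \<rho> ^ n / (mean - 1))"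
        using \<rho>_gt_1 by (intro summable_divide tail_gf_summable_real) auto
      show "norm ((if n = 0 then 0 else tail n / (mean - 1)) * \<rho> ^ n) \<le> tail n * \<rho> ^ n / (mean - 1)"
        if "n \<ge> 0" for n
        using m tail_nonneg[of n] \<rho>_gt_1 by (auto simp: abs_mult power_abs)
    qed
  qed (use m tail_nonneg \<rho>_gt_1 in auto)
qed

end

section \<open>Kendall's theorem with explicit constants\<close>

context renewal_law begin

lemma tail_gf_cnj:
  assumes "cmod z \<le> \<rho>"
  shows "tail_gf (cnj z) = cnj (tail_gf z)"
proof -
  have "(\<lambda>n. of_real (tail n) * z ^ n) sums tail_gf z"
    unfolding tail_gf_def using tail_gf_summable[OF assms] by (rule summable_sums)
  hence "(\<lambda>n. cnj (of_real (tail n) * z ^ n)) sums cnj (tail_gf z)" by (simp only: sums_cnj)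
  thus ?thesis by (simp add: tail_gf_def sums_iff)
qed

text \<open>
  Removing the mass \<open>b\<close> at time \<open>1\<close> and shifting by one leaves a law \<open>q\<close> of mean
  \<open>(mean - 1) / (1 - b)\<close> with \<open>1 - pgf z = (1 - b) (1 + \<beta> (1 - z) - z q(z))\<close>; then
  \<open>cis_pgf_distance\<close> applies, and division by \<open>|1 - z|\<close> gives \<open>tail_gf\<close>.  At \<open>z = 1\<close> the
  value is the mean, which is at least \<open>1 \<ge> (1 - b) \<beta>\<close>.
\<close>
lemma tail_gf_unit_circle:
  assumes b: "0 < b" "b < 1" "b \<le> p 1" and z: "cmod z = 1"
  shows "(1 - b) * D b ((mean - 1) / (1 - b)) \<le> cmod (tail_gf z)"
proof -
  define \<alpha> where "\<alpha> = (mean - 1) / (1 - b)"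
  define \<beta> where "\<beta> = b / (1 - b)"
  have \<alpha>: "0 \<le> \<alpha>" using mean_ge_1 b by (simp add: \<alpha>_def)
  have \<beta>: "0 < \<beta>" "(1 - b) * \<beta> = b" using b by (auto simp: \<beta>_def)
  define t where "t = pi / (1 + \<alpha>)"
  have D: "D b \<alpha> = chord_bound \<beta> (2 * sin (t / 2))"
    using D_eq_chord_bound[OF b(1,2) \<alpha>] by (simp add: \<beta>_def t_def)
  have "pi * 1 \<le> pi * (1 + \<alpha>)" using \<alpha> by (intro mult_left_mono) auto
  hence t: "0 < t" "t \<le> pi" using \<alpha> by (auto simp: t_def divide_le_eq)
  hence "0 < sin (t / 2)" using pi_gt_zero by (intro sin_gt_zero) linarith+
  hence "D b \<alpha> \<le> \<beta>" unfolding D using \<beta> by (intro chord_bound_le) auto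
  hence "(1 - b) * D b \<alpha> \<le> (1 - b) * \<beta>" using b by (intro mult_left_mono) auto
  hence at_1: "(1 - b) * D b \<alpha> \<le> cmod (tail_gf 1)"
    using \<beta> b mean_ge_1 by (simp add: tail_gf_1)
  define q where "q n = (p (Suc n) - (if n = 0 then b else 0)) / (1 - b)" for n
  have q_nonneg: "0 \<le> q n" for n using b p_nonneg by (simp add: q_def)
  have "(\<lambda>n. p (Suc n)) sums (1 - p 0)" using p_sums by (simp only: sums_Suc_iff) (simp add: p_0)
  hence "(\<lambda>n. (p (Suc n) - (if n = 0 then b else 0)) / (1 - b)) sums ((1 - p 0 - b) / (1 - b))"
    by (intro sums_divide sums_diff sums_single)
  hence q_sums: "q sums 1" using b by (simp add: q_def[abs_def] p_0)
  have "(\<lambda>n. real (Suc n) * p (Suc n)) sums (mean - real 0 * p 0)"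
    using first_moment_sums sums_Suc_iff[of "\<lambda>n. real n * p n"] by simp
  moreover have "(\<lambda>n. p (Suc n)) sums 1" using \<open>(\<lambda>n. p (Suc n)) sums (1 - p 0)\<close> by (simp add: p_0)
  ultimately have "(\<lambda>n. (real (Suc n) * p (Suc n) - p (Suc n)) / (1 - b)) sums ((mean - real 0 * p 0 - 1) / (1 - b))"
    by (intro sums_divide sums_diff)
  moreover have "(\<lambda>n. (real (Suc n) * p (Suc n) - p (Suc n)) / (1 - b)) = (\<lambda>n. real n * q n)"
    by (auto simp: q_def algebra_simps)
  ultimately have q_mean: "(\<lambda>n. real n * q n) sums \<alpha>" by (simp add: \<alpha>_def)
  have upper: "(1 - b) * D b \<alpha> \<le> cmod (tail_gf (cis \<theta>))" if \<theta>: "0 < \<theta>" "\<theta> \<le> pi" for \<theta>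
  proof -
    have ne: "cis \<theta> \<noteq> 1"
    proof
      assume "cis \<theta> = 1"
      hence "cos \<theta> = cos 0" by (metis cis.sel(1) cis_zero one_complex.sel(1) cos_zero)
      thus False using \<theta> cos_inj_pi[of \<theta> 0] by auto
    qed
    define H where "H = (\<Sum>n. of_real (q n) * cis \<theta> ^ n)"
    have "summable (\<lambda>n. of_real (q n) * cis \<theta> ^ n)"
      by (rule summable_comparison_test'[of q 0]) 
         (use q_sums q_nonneg in \<open>auto simp: norm_mult norm_power sums_iff\<close>)
    hence "(\<lambda>n. of_real (1 - b) * (of_real (q n) * cis \<theta> ^ n) + (if n = 0 then of_real b else 0))
             sums (of_real (1 - b) * H + of_real b)"
      unfolding H_def by (intro sums_add sums_mult sums_single summable_sums)
    moreover have "of_real (1 - b) * (of_real (q n) * cis \<theta> ^ n) + (if n = 0 then of_real b else 0)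
                     = of_real (p (Suc n)) * cis \<theta> ^ n" for n
      using b by (auto simp: q_def field_simps)
    ultimately have "(\<lambda>n. of_real (p (Suc n)) * cis \<theta> ^ n) sums (of_real (1 - b) * H + of_real b)"
      by simp
    from sums_mult[OF this, of "cis \<theta>"]
    have "(\<lambda>n. of_real (p (Suc n)) * cis \<theta> ^ Suc n) sums (cis \<theta> * (of_real (1 - b) * H + of_real b))"
      by (simp add: mult_ac)
    hence "(\<lambda>n. of_real (p n) * cis \<theta> ^ n) sums (cis \<theta> * (of_real (1 - b) * H + of_real b))"
      by (subst (asm) sums_Suc_iff) (simp add: p_0)
    hence pgf: "pgf (cis \<theta>) = cis \<theta> * (of_real (1 - b) * H + of_real b)"
      by (simp add: pgf_def sums_iff)
    have "1 - pgf (cis \<theta>) = of_real (1 - b) * (1 + of_real \<beta> * (1 - cis \<theta>) - cis \<theta> * H)"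
    proof -
      have *: "of_real (1 - b) * (of_real \<beta> :: complex) = of_real b" 
        by (simp only: of_real_mult[symmetric] \<beta>)
      have "of_real (1 - b) * (1 + of_real \<beta> * (1 - cis \<theta>) - cis \<theta> * H)
          = of_real (1 - b) + (of_real (1 - b) * of_real \<beta>) * (1 - cis \<theta>) - of_real (1 - b) * (cis \<theta> * H)"
        by (simp only: ring_distribs mult.assoc mult_1_right)
      also have "\<dots> = 1 - pgf (cis \<theta>)"
        unfolding * pgf by (simp add: algebra_simps)
      finally show ?thesis by simp
    qed
    hence "cmod (1 - pgf (cis \<theta>)) = (1 - b) * cmod (1 + of_real \<beta> * (1 - cis \<theta>) - cis \<theta> * H)"
      using b by (simp only: norm_mult norm_of_real)
    moreover have "chord_bound \<beta> (2 * sin (t / 2)) * cmod (1 - cis \<theta>)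
           \<le> cmod (1 + of_real \<beta> * (1 - cis \<theta>) - cis \<theta> * H)"
      unfolding H_def t_def using \<beta> q_nonneg q_sums q_mean \<theta> by (intro cis_pgf_distance) auto
    ultimately have "(1 - b) * (D b \<alpha> * cmod (1 - cis \<theta>)) \<le> cmod (1 - pgf (cis \<theta>))"
      using b by (simp add: D)
    also have "1 - pgf (cis \<theta>) = (1 - cis \<theta>) * tail_gf (cis \<theta>)"
      using ne \<rho>_gt_1 by (simp add: tail_gf_eq field_simps)
    finally have "(1 - b) * D b \<alpha> * cmod (1 - cis \<theta>) \<le> cmod (tail_gf (cis \<theta>)) * cmod (1 - cis \<theta>)"
      by (simp add: norm_mult mult_ac)
    thus ?thesis using ne by simp
  qed
  \<comment> \<open>The lower half of the circle follows by conjugation.\<close>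
  have "(1 - b) * D b \<alpha> \<le> cmod (tail_gf z)"
  proof -
    have "z \<noteq> 0" using z by auto
    hence zc: "z = cis (Arg z)" using cis_Arg[of z] z by (simp add: sgn_div_norm)
    have "- pi < Arg z" "Arg z \<le> pi" using Arg_bounded[of z] by auto
    then consider "0 < Arg z" "Arg z \<le> pi" | "Arg z = 0" | "0 < - Arg z" "- Arg z \<le> pi" by linarith
    thus ?thesis
    proof cases
      case 1 thus ?thesis using upper[of "Arg z"] zc by simp
    next
      case 2 
      hence "z = 1" using zc by simp
      thus ?thesis using at_1 by simp
    next
      case 3
      have "cis (- Arg z) = cnj z" by (subst (2) zc) (simp add: cis_cnj)
      thus ?thesis using upper[OF 3] tail_gf_cnj[of z] z \<rho>_gt_1 by simp
    qed
  qed
  thus ?thesis by (simp add: \<alpha>_def)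
qed

lemma tail_gf_lower_bound:
  assumes b: "0 < b" "b < 1" "b \<le> p 1" and z: "1 \<le> cmod z" "cmod z \<le> \<rho>"
  shows "(1 - b) * D b ((mean - 1) / (1 - b)) - (tail_gf (cmod z) - mean) \<le> cmod (tail_gf z)"
proof -
  define w where "w = z / of_real (cmod z)"
  have w: "cmod w = 1" "z = of_real (cmod z) * w" using z by (auto simp: w_def norm_divide)
  have "cmod (tail_gf w) \<le> cmod (tail_gf z) + cmod (tail_gf z - tail_gf w)"
    using norm_triangle_sub[of "tail_gf w" "tail_gf z"] by (simp add: norm_minus_commute)
  thus ?thesis
    using tail_gf_unit_circle[OF b w(1)] tail_gf_radial_diff_le[OF z w] by linarith
qed

text \<open>
  The assumption \<open>gap\<close> keeps \<open>tail_gf\<close> free of zeros in the open disc of radius \<open>\<rho>\<close>: between radius \<open>1\<close> and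
  \<open>\<rho>\<close> by \<open>tail_gf_lower_bound\<close>, inside the unit disc because \<open>|pgf z| < 1\<close>.  Hence the formal quotient
  of the two power series converges in that disc, which gives the summability beyond the unit disc.
\<close>
theorem kendall_renewal_bound:
  fixes u :: "nat \<Rightarrow> real" and z :: complex
  assumes b: "0 < b" "b < 1" "b \<le> p 1" and p1: "p 1 < 1"
    and u_0: "u 0 = 1" and u_rec: "\<And>n. 0 < n \<Longrightarrow> u n = (\<Sum>k=1..n. p k * u (n - k))"
    and gap: "tail_gf \<rho> - mean \<le> (1 - b) * D b ((mean - 1) / (1 - b))"
    and z: "1 < cmod z" "cmod z < \<rho>"
  shows "summable (\<lambda>n. of_real (u n - 1 / mean) * z ^ n)"
    and "cmod (\<Sum>n. of_real (u n - 1 / mean) * z ^ n)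
           \<le> (tail_gf (cmod z) - mean) / (mean * (cmod z - 1)
               * ((1 - b) * D b ((mean - 1) / (1 - b)) - (tail_gf (cmod z) - mean)))"
proof -
  define \<delta> where "\<delta> = (1 - b) * D b ((mean - 1) / (1 - b))"
  define r where "r = cmod z"
  define p' where "p' = (\<lambda>n. if n = 0 then 0 else tail n / (mean - 1))"
  \<comment> \<open>The coefficients \<open>e\<close> are the tails of the tails; they expand \<open>(mean - tail_gf z) / (1 - z)\<close>.\<close>
  interpret T: renewal_law p' \<rho> unfolding p'_def by (rule normalized_tail_law(1)[OF p1])
  have m: "1 < mean" by (rule normalized_tail_law(2)[OF p1])
  define e where "e n = (mean - 1) * T.tail n" for n
  have e: "e n = mean - (\<Sum>k\<le>n. tail k)" for n
  proof -
    have "(\<Sum>k\<le>n. p' k) = ((\<Sum>k\<le>n. tail k) - 1) / (mean - 1)"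
      by (induction n) (use m in \<open>auto simp: p'_def tail_0 field_simps\<close>)
    thus ?thesis using m by (simp add: e_def T.tail_def field_simps)
  qed
  have T_pgf: "T.pgf x = (tail_gf x - 1) / (mean - 1)" if "0 \<le> x" "x \<le> \<rho>" for x :: real
  proof -
    have "(\<lambda>n. (tail n * x ^ n - (if n = 0 then 1 else 0)) / (mean - 1)) sums ((tail_gf x - 1) / (mean - 1))"
      unfolding tail_gf_def using tail_gf_summable_real[OF that]
      by (intro sums_divide sums_diff sums_single) (simp add: summable_sums)
    moreover have "(tail n * x ^ n - (if n = 0 then 1 else 0)) / (mean - 1) = p' n * x ^ n" for n
      by (auto simp: p'_def tail_0)
    ultimately show ?thesis by (simp add: T.pgf_def sums_iff)
  qed
  define Cf where "Cf = Abs_fps (\<lambda>n. complex_of_real (tail n))"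
  define Ef where "Ef = Abs_fps (\<lambda>n. complex_of_real (e n))"
  define Bf where "Bf = Abs_fps (\<lambda>n. complex_of_real (p n))"
  define Uf where "Uf = Abs_fps (\<lambda>n. complex_of_real (u n))"
  define Gf where "Gf = Abs_fps (\<lambda>n. complex_of_real (u n - 1 / mean))"
  define Vf where "Vf = Abs_fps (\<lambda>n. 1 :: complex)"
  have "Uf - Bf * Uf = 1"
  proof (rule fps_ext)
    fix n show "fps_nth (Uf - Bf * Uf) n = fps_nth 1 n"
    proof (cases "n = 0")
      case False
      hence "(\<Sum>i=0..n. p i * u (n - i)) = u n"
        using u_rec[of n] by (subst sum.atLeast_Suc_atMost) (auto simp: p_0)
      moreover have "fps_nth (Bf * Uf) n = of_real (\<Sum>i=0..n. p i * u (n - i))"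
        by (simp add: fps_mult_nth Bf_def Uf_def)
      ultimately show ?thesis using False by (simp add: Uf_def)
    qed (simp add: Uf_def Bf_def u_0 p_0)
  qed
  hence UB: "Uf * (1 - Bf) = 1" by (simp add: algebra_simps)
  have CX: "(1 - fps_X) * Cf = 1 - Bf"
  proof (rule fps_ext)
    fix n show "fps_nth ((1 - fps_X) * Cf) n = fps_nth (1 - Bf) n"
      using tail_Suc[of "n - 1"] by (cases n) (auto simp: left_diff_distrib Cf_def Bf_def tail_0 p_0)
  qed
  have EX: "(1 - fps_X) * Ef = fps_const (of_real mean) - Cf"
  proof (rule fps_ext)
    fix n show "fps_nth ((1 - fps_X) * Ef) n = fps_nth (fps_const (of_real mean) - Cf) n"
      by (cases n) (auto simp: left_diff_distrib Cf_def Ef_def e tail_0)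
  qed
  have VX: "(1 - fps_X) * Vf = 1"
  proof (rule fps_ext)
    fix n show "fps_nth ((1 - fps_X) * Vf) n = fps_nth 1 n"
      by (cases n) (auto simp: left_diff_distrib Vf_def)
  qed
  have G: "Gf * fps_const (of_real mean) = fps_const (of_real mean) * Uf - Vf"
    using m by (intro fps_ext) (simp add: Gf_def Uf_def Vf_def algebra_simps)
  \<comment> \<open>Everything is multiplied by \<open>1 - X\<close>, which turns \<open>Cf\<close> into \<open>1 - Bf\<close>, \<open>Ef\<close> into \<open>mean - Cf\<close> and \<open>Vf\<close> into \<open>1\<close>.\<close>
  have "(1 - fps_X) * (Gf * fps_const (of_real mean) * Cf)
          = fps_const (of_real mean) * (Uf * ((1 - fps_X) * Cf)) - ((1 - fps_X) * Vf) * Cf"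
    unfolding G by (simp add: algebra_simps)
  also have "\<dots> = (1 - fps_X) * Ef" unfolding CX VX UB EX by simp
  finally have GC: "Gf * fps_const (of_real mean) * Cf = Ef"
  proof (subst (asm) mult_cancel_left, elim disjE)
    assume "(1 - fps_X :: complex fps) = 0"
    hence "fps_nth (1 - fps_X :: complex fps) 0 = fps_nth 0 0" by (rule arg_cong)
    thus ?thesis by simp
  qed
  have "fps_nth Cf 0 = 1" by (simp add: Cf_def tail_0)
  hence "Cf \<noteq> 0" by auto
  hence quot: "Ef / Cf = Gf * fps_const (of_real mean)" unfolding GC[symmetric] by simp
  have rad_C: "ereal \<rho> \<le> fps_conv_radius Cf"
    using conv_radius_geI[of "\<lambda>n. complex_of_real (tail n)" "of_real \<rho>"] tail_gf_summable[of "of_real \<rho> :: complex"] \<rho>_gt_1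
    by (simp add: fps_conv_radius_def Cf_def)
  have rad_E: "ereal \<rho> \<le> fps_conv_radius Ef"
    using conv_radius_geI[of "\<lambda>n. complex_of_real (e n)" "of_real \<rho>"] 
      summable_mult[OF T.tail_gf_summable[of "of_real \<rho> :: complex"], of "of_real (mean - 1)"] \<rho>_gt_1
    by (simp add: fps_conv_radius_def Ef_def e_def mult_ac)
  have eval_C: "eval_fps Cf w = tail_gf w" for w
    by (simp add: eval_fps_def Cf_def tail_gf_def)
  have eval_E: "eval_fps Ef w = of_real (mean - 1) * T.tail_gf w" if "cmod w \<le> \<rho>" for w
    unfolding T.tail_gf_def using suminf_mult[OF T.tail_gf_summable[OF that], of "of_real (mean - 1)"]
    by (simp add: eval_fps_def Ef_def e_def mult_ac)
  have nz: "eval_fps Cf w \<noteq> 0" if "w \<in> eball 0 \<rho>" for w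
  proof (cases "cmod w < 1")
    case True thus ?thesis unfolding eval_C by (rule tail_gf_nonzero_disc)
  next
    case False
    hence "0 < \<delta> - (tail_gf (cmod w) - mean)"
      using tail_gf_strict_mono[of "cmod w" \<rho>] gap that p1 by (auto simp: \<delta>_def)
    also have "\<dots> \<le> cmod (tail_gf w)"
      unfolding \<delta>_def using False that b by (intro tail_gf_lower_bound) auto
    finally show ?thesis by (auto simp: eval_C)
  qed
  have R: "Min {ereal \<rho>, fps_conv_radius Ef, fps_conv_radius Cf} = ereal \<rho>"
    using rad_C rad_E by (auto simp: min_def)
  have pos: "0 < fps_conv_radius Ef" "0 < fps_conv_radius Cf" "0 < ereal \<rho>"
    using rad_C rad_E \<rho>_gt_1 by (auto intro: less_le_trans[of 0 "ereal \<rho>"])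
  have rad_quot: "ereal \<rho> \<le> fps_conv_radius (Ef / Cf)"
    using fps_conv_radius_divide'[OF pos nz] unfolding R .
  have "(\<lambda>n. fps_nth (Ef / Cf) n * z ^ n) sums eval_fps (Ef / Cf) z"
    using rad_quot z by (intro sums_eval_fps less_le_trans[OF _ rad_quot]) simp
  also have "eval_fps (Ef / Cf) z = of_real (mean - 1) * T.tail_gf z / tail_gf z"
    using eval_fps_divide'[OF pos nz, of z] z unfolding R by (simp add: eval_C eval_E)
  finally have "(\<lambda>n. fps_nth (Ef / Cf) n * z ^ n / of_real mean) sums 
      (of_real (mean - 1) * T.tail_gf z / tail_gf z / of_real mean)" by (rule sums_divide)
  moreover have "fps_nth (Ef / Cf) n * z ^ n / of_real mean = of_real (u n - 1 / mean) * z ^ n" for n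
    unfolding quot using m by (simp add: Gf_def)
  ultimately have S: "(\<lambda>n. of_real (u n - 1 / mean) * z ^ n) sums 
      (of_real (mean - 1) * T.tail_gf z / tail_gf z / of_real mean)" by simp
  thus "summable (\<lambda>n. of_real (u n - 1 / mean) * z ^ n)" by (rule sums_summable)
  have "cmod (T.tail_gf z) \<le> (\<Sum>n. T.tail n * r ^ n)" unfolding T.tail_gf_def r_def
    by (rule norm_suminf_le) (use z T.tail_nonneg in \<open>auto simp: norm_mult norm_power intro: T.tail_gf_summable_real\<close>)
  also have "\<dots> = T.tail_gf r" by (simp add: T.tail_gf_def)
  also have "\<dots> = ((tail_gf r - 1) / (mean - 1) - 1) / (r - 1)"
    using z by (simp add: T.tail_gf_eq T_pgf r_def)
  finally have "(mean - 1) * cmod (T.tail_gf z) \<le> (mean - 1) * (((tail_gf r - 1) / (mean - 1) - 1) / (r - 1))"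
    using m by (intro mult_left_mono) auto
  also have "(mean - 1) * (((tail_gf r - 1) / (mean - 1) - 1) / (r - 1)) = (tail_gf r - mean) / (r - 1)"
  proof -
    define k where "k = mean - 1"
    have "k \<noteq> 0" using m by (simp add: k_def)
    hence "k * ((tail_gf r - 1) / k - 1) = tail_gf r - 1 - k" by (simp add: field_simps)
    thus ?thesis by (simp add: k_def)
  qed
  finally have num: "(mean - 1) * cmod (T.tail_gf z) \<le> (tail_gf r - mean) / (r - 1)" .
  have gr: "0 < \<delta> - (tail_gf r - mean)" 
    using tail_gf_strict_mono[of r \<rho>] gap z p1 by (auto simp: \<delta>_def r_def)
  have den: "\<delta> - (tail_gf r - mean) \<le> cmod (tail_gf z)"
    unfolding \<delta>_def r_def using z b by (intro tail_gf_lower_bound) auto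
  have nn: "0 \<le> (tail_gf r - mean) / (r - 1)"
    by (rule order_trans[OF _ num]) (use m in auto)
  have "cmod (\<Sum>n. of_real (u n - 1 / mean) * z ^ n) = (mean - 1) * cmod (T.tail_gf z) / cmod (tail_gf z) / mean"
    unfolding sums_unique[OF S, symmetric] norm_divide norm_mult norm_of_real using m by simp
  also have "\<dots> \<le> (tail_gf r - mean) / (r - 1) / (\<delta> - (tail_gf r - mean)) / mean"
    using num gr den m nn by (intro divide_right_mono frac_le) auto
  also have "\<dots> = (tail_gf r - mean) / (mean * (r - 1) * (\<delta> - (tail_gf r - mean)))"
    by (simp add: mult_ac)
  finally show "cmod (\<Sum>n. of_real (u n - 1 / mean) * z ^ n)
           \<le> (tail_gf (cmod z) - mean) / (mean * (cmod z - 1)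
               * ((1 - b) * D b ((mean - 1) / (1 - b)) - (tail_gf (cmod z) - mean)))"
    by (simp only: r_def \<delta>_def)
qed

end

section \<open>The largest convex minorant\<close>

text \<open>
  Logarithmic convexity of power series with nonnegative coefficients.  With
  \<open>l = (1 - t) ln (f x) + t ln (f y)\<close>, convexity of the exponential is applied to each
  \<open>exp (n z - l)\<close>; the weighted terms on the right add up to \<open>(1 - t) + t = 1\<close>.
\<close>
lemma convex_on_ln_exp_series:
  fixes a :: "nat \<Rightarrow> real"
  assumes I: "convex I" and a: "\<And>n. 0 \<le> a n"
    and summable: "\<And>x. x \<in> I \<Longrightarrow> summable (\<lambda>n. a n * exp (real n * x))"
    and pos: "\<And>x. x \<in> I \<Longrightarrow> 0 < (\<Sum>n. a n * exp (real n * x))"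
  shows "convex_on I (\<lambda>x. ln (\<Sum>n. a n * exp (real n * x)))"
proof (rule convex_onI[OF _ I])
  fix t x y :: real assume t: "0 < t" "t < 1" and x: "x \<in> I" and y: "y \<in> I"
  define f where "f = (\<lambda>x. \<Sum>n. a n * exp (real n * x))"
  define z where "z = (1 - t) *\<^sub>R x + t *\<^sub>R y"
  define l where "l = (1 - t) * ln (f x) + t * ln (f y)"
  have z: "z \<in> I" unfolding z_def using I x y t by (intro convexD) auto
  have fpos: "0 < f x" "0 < f y" "0 < f z" using pos x y z by (auto simp: f_def)
  have "exp (real n * z - l) \<le> (1 - t) * (exp (real n * x) / f x) + t * (exp (real n * y) / f y)" for n
  proof -
    have "exp ((1 - t) *\<^sub>R (real n * x - ln (f x)) + t *\<^sub>R (real n * y - ln (f y)))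
            \<le> (1 - t) * exp (real n * x - ln (f x)) + t * exp (real n * y - ln (f y))"
      using t by (intro convex_onD[OF exp_convex]) auto
    also have "(1 - t) *\<^sub>R (real n * x - ln (f x)) + t *\<^sub>R (real n * y - ln (f y)) = real n * z - l"
      by (simp add: z_def l_def algebra_simps)
    finally show ?thesis using fpos by (simp add: exp_diff)
  qed
  hence le: "a n * exp (real n * z) * exp (- l)
          \<le> (1 - t) * (a n * exp (real n * x) / f x) + t * (a n * exp (real n * y) / f y)" for n
    using mult_left_mono[OF _ a[of n]] by (fastforce simp: exp_diff exp_minus algebra_simps divide_inverse)
  have sm: "(\<lambda>n. a n * exp (real n * w)) sums f w" if "w \<in> I" for w
    using summable[OF that] by (simp add: f_def summable_sums)
  have "f z * exp (- l) \<le> (1 - t) * (f x / f x) + t * (f y / f y)"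
    by (rule sums_le[OF le sums_mult2[OF sm[OF z]]]) (intro sums_mult sums_add sums_divide sm x y)
  hence "f z * exp (- l) \<le> 1" using fpos by simp
  hence "f z \<le> exp l" by (simp add: exp_minus field_simps)
  hence "ln (f z) \<le> l" using fpos by (metis ln_exp ln_le_cancel_iff exp_gt_zero)
  thus "ln (\<Sum>n. a n * exp (real n * ((1 - t) *\<^sub>R x + t *\<^sub>R y)))
     \<le> (1 - t) * ln (\<Sum>n. a n * exp (real n * x)) + t * ln (\<Sum>n. a n * exp (real n * y))"
    by (simp add: f_def z_def l_def)
qed

text \<open>
  The pointwise supremum of all convex minorants is again one, provided there is at least one; hence
  the choice in the definition of \<open>Fbar\<close> is not vacuous.
\<close>
lemma Fbar_greatest:
  assumes "convex_minorant R L bb b \<alpha> F0"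
  shows "convex_minorant R L bb b \<alpha> (Fbar R L bb b \<alpha>)"
    and "\<And>G x. convex_minorant R L bb b \<alpha> G \<Longrightarrow> x \<in> J R L bb \<Longrightarrow> G x \<le> Fbar R L bb b \<alpha> x"
proof -
  define S where "S = {G. convex_minorant R L bb b \<alpha> G}"
  define F where "F = (\<lambda>x. SUP G\<in>S. G x)"
  have ne: "S \<noteq> {}" using assms by (auto simp: S_def)
  have zero: "G 0 = 0" if "G \<in> S" for G using that by (auto simp: S_def convex_minorant_def)
  have below: "G x \<le> F1 R L bb b \<alpha> x" if "G \<in> S" "x \<in> J R L bb" "x \<noteq> 0" for G x
    using that by (auto simp: S_def convex_minorant_def)
  have bdd: "bdd_above ((\<lambda>G. G x) ` S)" if "x \<in> J R L bb" for x
    by (rule bdd_aboveI[where M = "if x = 0 then 0 else F1 R L bb b \<alpha> x"]) (use below that in \<open>auto simp: zero\<close>)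
  have upper: "G x \<le> F x" if "G \<in> S" "x \<in> J R L bb" for G x
    unfolding F_def using that bdd by (intro cSUP_upper) auto
  have cJ: "convex (J R L bb)" using assms by (auto simp: convex_minorant_def convex_on_def)
  have "convex_minorant R L bb b \<alpha> F"
    unfolding convex_minorant_def
  proof (intro conjI ballI)
    show "convex_on (J R L bb) F"
    proof (rule convex_onI[OF _ cJ])
      fix t x y :: real assume t: "0 < t" "t < 1" and xy: "x \<in> J R L bb" "y \<in> J R L bb"
      have "(SUP G\<in>S. G ((1 - t) *\<^sub>R x + t *\<^sub>R y)) \<le> (1 - t) * F x + t * F y"
      proof (rule cSUP_least[OF ne])
        fix G assume G: "G \<in> S"
        hence cG: "convex_on (J R L bb) G" by (simp add: S_def convex_minorant_def)
        have "G ((1 - t) *\<^sub>R x + t *\<^sub>R y) \<le> (1 - t) * G x + t * G y"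
          using convex_onD[OF cG, of t x y] t xy by simp
        also have "\<dots> \<le> (1 - t) * F x + t * F y"
          using upper[OF G] xy t by (intro add_mono mult_left_mono) auto
        finally show "G ((1 - t) *\<^sub>R x + t *\<^sub>R y) \<le> (1 - t) * F x + t * F y" .
      qed
      thus "F ((1 - t) *\<^sub>R x + t *\<^sub>R y) \<le> (1 - t) * F x + t * F y"
        by (subst F_def)
    qed
    have "(\<lambda>G. G 0) ` S = (\<lambda>G. 0) ` S" by (intro image_cong refl zero)
    hence "(\<lambda>G. G 0) ` S = {0}" using ne by (simp add: image_constant_conv)
    thus "F 0 = 0" by (simp add: F_def)
    show "F x \<le> F1 R L bb b \<alpha> x" if "x \<in> J R L bb - {0}" for x
      unfolding F_def using that below by (intro cSUP_least[OF ne]) auto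
  qed
  hence "\<exists>F. convex_minorant R L bb b \<alpha> F \<and>
     (\<forall>G. convex_minorant R L bb b \<alpha> G \<longrightarrow> (\<forall>x\<in>J R L bb. G x \<le> F x))"
    using upper by (auto simp: S_def)
  from someI_ex[OF this] show "convex_minorant R L bb b \<alpha> (Fbar R L bb b \<alpha>)"
    and "\<And>G x. convex_minorant R L bb b \<alpha> G \<Longrightarrow> x \<in> J R L bb \<Longrightarrow> G x \<le> Fbar R L bb b \<alpha> x"
    by (auto simp: Fbar_def)
qed

lemma convex_J:
  assumes "bb < 1"
  shows "convex (J R L bb)"
proof -
  define c where "c = 1 + alpha1 R L bb"
  have "(1 - bb) * exp (c * x) < 1 \<longleftrightarrow> inner c x < - ln (1 - bb)" for x
  proof -
    have "(1 - bb) * exp (c * x) = exp (ln (1 - bb) + c * x)" using assms by (simp add: exp_add)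
    also have "\<dots> < 1 \<longleftrightarrow> ln (1 - bb) + c * x < 0" by simp
    finally show ?thesis by auto
  qed
  hence eq: "J R L bb = {0..ln R} \<inter> {x. inner c x < - ln (1 - bb)}"
    by (auto simp: J_def c_def)
  show ?thesis unfolding eq by (intro convex_Int convex_real_interval convex_halfspace_lt)
qed

lemma ln_in_J_iff:
  assumes "0 < s"
  shows "ln s \<in> J R L bb \<longleftrightarrow> 1 \<le> s \<and> ln s \<le> ln R \<and> (1 - bb) * s powr (1 + alpha1 R L bb) < 1"
  using assms by (simp add: J_def powr_def)

lemma ln_in_J_if_less_r0_bar:
  assumes bb: "0 < bb" "bb < 1" and a1: "0 \<le> alpha1 R L bb"
    and s: "1 \<le> s" "ereal s < r0_bar R L bb b \<alpha>"
  shows "ln s \<in> J R L bb"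
proof -
  define a where "a = 1 + alpha1 R L bb"
  have a: "0 < a" using a1 by (simp add: a_def)
  have s': "s < R" "s < (1 - bb) powr (- (1 / a))" using s by (auto simp: r0_bar_def a_def)
  have "s powr a < ((1 - bb) powr (- (1 / a))) powr a"
    using s s' a by (intro powr_less_mono2) auto
  also have "\<dots> = (1 - bb) powr (- (1 / a) * a)" by (rule powr_powr)
  also have "- (1 / a) * a = - 1" using a by simp
  also have "(1 - bb) powr - 1 = 1 / (1 - bb)" using bb by (simp add: powr_minus_divide)
  finally have "(1 - bb) * s powr a < 1" using bb by (simp add: field_simps)
  thus ?thesis using s s' by (simp add: ln_in_J_iff a_def)
qed

lemma convex_from_origin_strict_mono:
  fixes F :: "real \<Rightarrow> real"
  assumes F: "convex_on I F" "F 0 = 0" and I: "0 \<in> I" "y \<in> I" and x: "0 < x" "x < y" and pos: "0 < F y"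
  shows "F x < F y"
proof -
  have "F ((1 - x / y) *\<^sub>R 0 + (x / y) *\<^sub>R y) \<le> (1 - x / y) * F 0 + (x / y) * F y"
    using x I by (intro convex_onD[OF F(1)]) auto
  hence "F x \<le> (x / y) * F y" using x F by simp
  also have "\<dots> < 1 * F y" using x pos by (intro mult_strict_right_mono) auto
  finally show ?thesis by simp
qed

text \<open>
  A radius \<open>s\<close> solves the equation for \<open>r0_alpha\<close> exactly when \<open>Fbar (ln s)\<close> equals the level
  \<open>ln (1 + D b \<alpha> / \<alpha>)\<close>.  Being convex, zero at \<open>0\<close> and
  positive elsewhere, \<open>Fbar\<close> is strictly increasing, so there is at most one solution, and the
  definite description picks it.  If \<open>Fbar\<close> had reached the level at \<open>ln r\<close>, the intermediate value
  theorem would put the solution at or below \<open>r\<close>.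
\<close>
lemma Fbar_less_level:
  assumes bb: "0 < bb" "bb < 1" and a1: "0 \<le> alpha1 R L bb" and R: "1 < R"
    and F0: "convex_minorant R L bb b \<alpha> F0" 
    and F0_pos: "\<And>x. x \<in> J R L bb \<Longrightarrow> 0 < x \<Longrightarrow> 0 < F0 x"
    and D: "0 < D b \<alpha> / \<alpha>"
    and r: "1 < r" "ereal r < r0_bar R L bb b \<alpha>"
  shows "Fbar R L bb b \<alpha> (ln r) < ln (1 + D b \<alpha> / \<alpha>)"
proof (rule ccontr)
  define F where "F = Fbar R L bb b \<alpha>"
  define l where "l = ln (1 + D b \<alpha> / \<alpha>)"
  assume "\<not> ?thesis"
  hence ge: "l \<le> F (ln r)" by (simp add: F_def l_def)
  have l: "0 < l" using D by (simp add: l_def)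
  have F: "convex_on (J R L bb) F" "F 0 = 0"
    using Fbar_greatest(1)[OF F0] by (auto simp: F_def convex_minorant_def)
  have pos: "0 < F x" if "x \<in> J R L bb" "0 < x" for x
    using F0_pos[OF that] Fbar_greatest(2)[OF F0 F0 that(1)] by (simp add: F_def)
  have J0: "0 \<in> J R L bb" using bb R by (simp add: J_def)
  have sol: "is_r0_solution R L bb b \<alpha> s \<longleftrightarrow> 1 < s \<and> ln s \<in> J R L bb \<and> F (ln s) = l" for s
  proof (cases "1 < s \<and> ln s \<in> J R L bb")
    case True
    hence Fp: "0 < F (ln s)" "0 < ln s" using pos by auto
    have "is_r0_solution R L bb b \<alpha> s \<longleftrightarrow> exp (ln s) = exp (ln s / F (ln s) * l)"
      using True D by (simp add: is_r0_solution_def kappa_def F_def[symmetric] powr_def l_def)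
    also have "\<dots> \<longleftrightarrow> F (ln s) = l" using Fp by (auto simp: field_simps)
    finally show ?thesis using True by simp
  qed (auto simp: is_r0_solution_def)
  have uniq: "s = s'" if "is_r0_solution R L bb b \<alpha> s" "is_r0_solution R L bb b \<alpha> s'" for s s'
  proof -
    have *: "\<not> ln u < ln v" if "is_r0_solution R L bb b \<alpha> u" "is_r0_solution R L bb b \<alpha> v" for u v
      using convex_from_origin_strict_mono[OF F J0, of "ln v" "ln u"] that l by (auto simp: sol)
    have "ln s = ln s'" using *[of s s'] *[of s' s] that by linarith
    thus ?thesis using that by (auto simp: is_r0_solution_def)
  qed
  obtain r' where r': "r < r'" "ereal r' < r0_bar R L bb b \<alpha>"
    using ereal_dense2[OF r(2)] by auto
  have inJ: "x \<in> J R L bb" if "0 \<le> x" "x \<le> ln r'" for x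
  proof -
    have "exp x \<le> r'" using that r' r by (metis exp_le_cancel_iff exp_ln less_trans zero_less_one)
    hence "ereal (exp x) < r0_bar R L bb b \<alpha>" using r'(2) by (meson ereal_less_eq(3) le_less_trans)
    from ln_in_J_if_less_r0_bar[OF bb a1 _ this] that show ?thesis by simp
  qed
  have lnr: "0 < ln r" "ln r < ln r'" "ln r \<in> J R L bb" using r r' inJ by auto
  \<comment> \<open>A convex function may jump at the end point \<open>0\<close> of its domain, so continuity is used on \<open>{y..ln r}\<close> only;
    by convexity \<open>Fbar\<close> is still below the level at the small point \<open>y\<close>.\<close>
  define y where "y = ln r * min 1 (l / F (ln r)) / 2"
  have Fr: "0 < F (ln r)" using pos lnr by simp
  have y: "0 < y" "y \<le> ln r" using lnr l Fr by (auto simp: y_def min_def field_simps)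
  have "F ((1 - y / ln r) *\<^sub>R 0 + (y / ln r) *\<^sub>R ln r) \<le> (1 - y / ln r) * F 0 + (y / ln r) * F (ln r)"
    using y lnr J0 by (intro convex_onD[OF F(1)]) auto
  hence "F y \<le> (y / ln r) * F (ln r)" using lnr F by simp
  also have "\<dots> \<le> (l / F (ln r)) * F (ln r)" 
    using lnr l Fr by (intro mult_right_mono) (auto simp: y_def min_def field_simps)
  finally have Fy: "F y \<le> l" using Fr by simp
  have "continuous_on {0<..<ln r'} F"
    by (rule convex_on_continuous) (auto intro!: convex_on_subset[OF F(1)] inJ)
  hence "continuous_on {y..ln r} F" by (rule continuous_on_subset) (use y lnr in auto)
  from IVT'[OF Fy ge y(2) this] obtain \<xi> where \<xi>: "y \<le> \<xi>" "\<xi> \<le> ln r" "F \<xi> = l" by auto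
  have "is_r0_solution R L bb b \<alpha> (exp \<xi>)" using \<xi> y inJ lnr by (auto simp: sol)
  hence "r0_alpha R L bb b \<alpha> = ereal (exp \<xi>)"
    using uniq by (auto simp: r0_alpha_def intro!: the_equality)
  moreover have "exp \<xi> \<le> r" using \<xi> r by (metis exp_le_cancel_iff exp_ln less_trans zero_less_one)
  ultimately show False using r(2) by (auto simp: r0_bar_def)
qed

section \<open>Kendall's theorem with the convex exponent\<close>

context renewal_law begin

text \<open>
  The bound on \<open>pgf s\<close> turns into the bound \<open>F1\<close> through
  \<open>tail_gf s - 1 = (pgf s - s) / (s - 1)\<close>.
\<close>
lemma ln_tail_gf_convex_minorant:
  assumes bb: "0 < bb" "bb < 1" and b: "b < 1" and R: "1 < R" and p1: "p 1 < 1"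
    and gf: "\<And>s. 1 \<le> s \<Longrightarrow> s \<le> R \<Longrightarrow> (1 - bb) * s powr (1 + alpha1 R L bb) < 1 \<Longrightarrow>
               summable (\<lambda>n. p n * s ^ n) \<and> (\<Sum>n. p n * s ^ n) \<le> L_bound R L bb b s"
  shows "convex_minorant R L bb b ((mean - 1) / (1 - b)) (\<lambda>x. ln ((tail_gf (exp x) - 1) / (mean - 1)))"
    and "\<And>x. x \<in> J R L bb \<Longrightarrow> 0 < x \<Longrightarrow> 0 < ln ((tail_gf (exp x) - 1) / (mean - 1))"
proof -
  define k where "k = mean - 1"
  define F0 where "F0 = (\<lambda>x. ln ((tail_gf (exp x) - 1) / k))"
  have k: "0 < k" using normalized_tail_law(2)[OF p1] by (simp add: k_def)
  have in_J: "1 \<le> exp x \<and> summable (\<lambda>n. p n * exp x ^ n) \<and> (\<Sum>n. p n * exp x ^ n) \<le> L_bound R L bb b (exp x)"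
    if "x \<in> J R L bb" for x
  proof -
    have "ln (exp x) \<in> J R L bb" using that by simp
    hence "1 \<le> exp x" "exp x \<le> R" "(1 - bb) * exp x powr (1 + alpha1 R L bb) < 1"
      using R by (auto simp: ln_in_J_iff simp del: ln_exp exp_le_one_iff one_le_exp_iff)
    thus ?thesis using gf by blast
  qed
  \<comment> \<open>Points of \<open>J\<close> may exceed \<open>ln \<rho>\<close>, so the facts about tails are used at radius \<open>exp x\<close>.\<close>
  have law: "renewal_law p (exp x)" if "x \<in> J R L bb" "0 < x" for x
    using in_J[OF that(1)] that p_0 p_nonneg p_sums by unfold_locales auto
  have sm: "summable (\<lambda>n. tail n * exp x ^ n)" if "x \<in> J R L bb" for x
  proof (cases "x = 0")
    case True thus ?thesis using tail_gf_summable_real[of 1] \<rho>_gt_1 by simp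
  next
    case False
    hence "0 < x" using that by (simp add: J_def)
    from renewal_law.tail_gf_summable_real[OF law[OF that this]] show ?thesis by simp
  qed
  have gt: "mean < tail_gf (exp x)" if "x \<in> J R L bb" "0 < x" for x
    using renewal_law.tail_gf_strict_mono[OF law[OF that], of 1 "exp x"] that p1 by (simp add: tail_gf_1)
  have ge: "mean \<le> tail_gf (exp x)" if "x \<in> J R L bb" for x
    using gt[OF that] that by (cases "x = 0") (auto simp: tail_gf_1 J_def)
  define a where "a n = (if n = 0 then 0 else tail n / k)" for n
  have a_sums: "(\<lambda>n. a n * exp (real n * x)) sums ((tail_gf (exp x) - 1) / k)" if "x \<in> J R L bb" for x
  proof -
    have "(\<lambda>n. (tail n * exp x ^ n - (if n = 0 then 1 else 0)) / k) sums ((tail_gf (exp x) - 1) / k)"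
      unfolding tail_gf_def using sm[OF that]
      by (intro sums_divide sums_diff sums_single) (simp add: summable_sums)
    moreover have "(tail n * exp x ^ n - (if n = 0 then 1 else 0)) / k = a n * exp (real n * x)" for n
      by (auto simp: a_def tail_0 exp_of_nat_mult)
    ultimately show ?thesis by simp
  qed
  have F0_eq: "F0 x = ln (\<Sum>n. a n * exp (real n * x))" if "x \<in> J R L bb" for x
    using a_sums[OF that] by (simp add: F0_def sums_iff)
  have "convex_on (J R L bb) (\<lambda>x. ln (\<Sum>n. a n * exp (real n * x)))"
  proof (rule convex_on_ln_exp_series[OF convex_J[OF bb(2)]])
    show "0 \<le> a n" for n using k tail_nonneg by (simp add: a_def)
    show "summable (\<lambda>n. a n * exp (real n * x))" if "x \<in> J R L bb" for x
      using a_sums[OF that] by (rule sums_summable)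
    show "0 < (\<Sum>n. a n * exp (real n * x))" if "x \<in> J R L bb" for x
      using a_sums[OF that] ge[OF that] k by (simp add: sums_iff k_def)
  qed
  hence "convex_on (J R L bb) F0"
    using F0_eq convex_J[OF bb(2), of R L] by (simp add: convex_on_def convex_def)
  moreover have "F0 0 = 0" using k by (simp add: F0_def tail_gf_1 k_def)
  moreover have "F0 x \<le> F1 R L bb b (k / (1 - b)) x" if "x \<in> J R L bb - {0}" for x
  proof -
    have x: "x \<in> J R L bb" "0 < x" using that by (auto simp: J_def)
    define s where "s = exp x"
    have s: "1 < s" using x by (simp add: s_def)
    have "tail_gf s = (pgf s - 1) / (s - 1)"
      using renewal_law.tail_gf_eq[OF law[OF x], of s] s by (simp add: s_def)
    also have "\<dots> \<le> (L_bound R L bb b s - 1) / (s - 1)"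
      using in_J[OF x(1)] s by (intro divide_right_mono) (auto simp: pgf_def s_def)
    finally have "tail_gf s - 1 \<le> (L_bound R L bb b s - 1) / (s - 1) - 1" by simp
    also have "\<dots> = (L_bound R L bb b s - s) / (s - 1)" using s by (simp add: field_simps)
    finally have "(tail_gf s - 1) / k \<le> (L_bound R L bb b s - s) / (s - 1) / k"
      using k by (intro divide_right_mono) auto
    moreover have "0 < (tail_gf s - 1) / k" using gt[OF x] k by (simp add: k_def s_def)
    ultimately have "F0 x \<le> ln ((L_bound R L bb b s - s) / (s - 1) / k)"
      unfolding F0_def s_def[symmetric] by simp
    thus ?thesis using b by (simp add: F1_def s_def mult.commute)
  qed
  ultimately show "convex_minorant R L bb b ((mean - 1) / (1 - b)) (\<lambda>x. ln ((tail_gf (exp x) - 1) / (mean - 1)))"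
    by (simp add: convex_minorant_def F0_def k_def)
  show "0 < ln ((tail_gf (exp x) - 1) / (mean - 1))" if "x \<in> J R L bb" "0 < x" for x
    using gt[OF that] k by (simp add: k_def)
qed

end

text \<open>
  Some radius \<open>\<rho>\<close> strictly between \<open>r\<close> and \<open>r0_bar\<close> serves as radius of convergence.  The level
  estimate for \<open>Fbar\<close> at \<open>\<rho>\<close> supplies the gap condition, and the one at \<open>r\<close> makes the denominator of the
  bound positive.
\<close>
theorem kendall_convex_minorant_bound:
  fixes p u :: "nat \<Rightarrow> real" and z :: complex
  assumes p: "p 0 = 0" "\<And>n. 0 \<le> p n" "p sums 1" and p1: "b \<le> p 1" "p 1 < 1"
    and m: "(\<lambda>n. 1 - (\<Sum>k\<le>n. p k)) sums m"
    and u_0: "u 0 = 1" and u_rec: "\<And>n. 0 < n \<Longrightarrow> u n = (\<Sum>k=1..n. p k * u (n - k))"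
    and b: "0 < b" "b < 1" and bb: "0 < bb" "bb < 1" and R: "1 < R" and a1: "0 \<le> alpha1 R L bb"
    and gf: "\<And>s. 1 \<le> s \<Longrightarrow> s \<le> R \<Longrightarrow> (1 - bb) * s powr (1 + alpha1 R L bb) < 1 \<Longrightarrow>
               summable (\<lambda>n. p n * s ^ n) \<and> (\<Sum>n. p n * s ^ n) \<le> L_bound R L bb b s"
    and \<alpha>: "\<alpha> = (m - 1) / (1 - b)"
    and r: "1 < r" "ereal r < r0_bar R L bb b \<alpha>" and z: "cmod z = r"
  shows "summable (\<lambda>n. of_real (u n - 1 / m) * z ^ n)"
    and "cmod (\<Sum>n. of_real (u n - 1 / m) * z ^ n)
           \<le> (1 / m) * (r powr kappa R L bb b \<alpha> r - 1)
               / ((r - 1) * (D b \<alpha> / \<alpha> - r powr kappa R L bb b \<alpha> r + 1))"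
proof -
  obtain \<rho> where \<rho>: "r < \<rho>" "ereal \<rho> < r0_bar R L bb b \<alpha>"
    using ereal_dense2[OF r(2)] by auto
  have \<rho>J: "ln \<rho> \<in> J R L bb" and rJ: "ln r \<in> J R L bb"
    using ln_in_J_if_less_r0_bar[OF bb a1] r \<rho> by auto
  interpret renewal_law p \<rho>
  proof
    have "1 \<le> \<rho>" "\<rho> \<le> R" "(1 - bb) * \<rho> powr (1 + alpha1 R L bb) < 1"
      using \<rho>J r \<rho> R by (auto simp: ln_in_J_iff)
    thus "summable (\<lambda>n. p n * \<rho> ^ n)" using gf by blast
  qed (use p r \<rho> in auto)
  have mean: "mean = m" using sums_unique2[OF tail_sums_mean] m by (simp add: tail_def[abs_def])
  have m1: "1 < m" using normalized_tail_law(2)[OF p1(2)] by (simp add: mean)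
  define k where "k = m - 1"
  have k: "0 < k" "(1 - b) * \<alpha> = k" using m1 b by (auto simp: k_def \<alpha>)
  have \<alpha>_pos: "0 < \<alpha>" using m1 b by (simp add: \<alpha>)
  have "pi * 1 \<le> pi * (1 + \<alpha>)" using \<alpha>_pos by (intro mult_left_mono) auto
  hence t: "0 < pi / (1 + \<alpha>)" "pi / (1 + \<alpha>) \<le> pi" using \<alpha>_pos by (auto simp: divide_le_eq)
  define t where "t = pi / (1 + \<alpha>)"
  have "0 < sin (t / 2)" using t pi_gt_zero unfolding t_def[symmetric] by (intro sin_gt_zero) linarith+
  hence D: "0 < D b \<alpha>"
    unfolding D_eq_chord_bound[OF b less_imp_le[OF \<alpha>_pos]] t_def[symmetric]
    using b by (intro chord_bound_pos) auto
  define d where "d = D b \<alpha> / \<alpha>"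
  have d: "0 < d" "k * d = (1 - b) * D b \<alpha>" using D \<alpha>_pos by (auto simp: d_def k(2)[symmetric])
  define F0 where "F0 = (\<lambda>x. ln ((tail_gf (exp x) - 1) / k))"
  note minorant' = ln_tail_gf_convex_minorant[OF bb b(2) R p1(2) gf, unfolded mean, folded \<alpha> k_def]
  have minorant: "convex_minorant R L bb b \<alpha> F0"
    and F0_pos: "\<And>x. x \<in> J R L bb \<Longrightarrow> 0 < x \<Longrightarrow> 0 < F0 x"
    using minorant' by (auto simp: F0_def)
  have level: "Fbar R L bb b \<alpha> (ln s) < ln (1 + d)" if "1 < s" "ereal s < r0_bar R L bb b \<alpha>" for s
    unfolding d_def using that d
    by (intro Fbar_less_level[OF bb a1 R minorant F0_pos]) (auto simp: d_def)
  have le: "tail_gf s - m \<le> k * (exp (Fbar R L bb b \<alpha> (ln s)) - 1)" 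
    if s: "1 < s" "s \<le> \<rho>" "ln s \<in> J R L bb" for s
  proof -
    have "m < tail_gf s" 
      using tail_gf_strict_mono[of 1 s] s p1 by (simp add: tail_gf_1 mean)
    hence pos: "0 < (tail_gf s - 1) / k" using m1 k by simp
    have "F0 (ln s) \<le> Fbar R L bb b \<alpha> (ln s)"
      using Fbar_greatest(2)[OF minorant minorant s(3)] .
    hence "exp (F0 (ln s)) \<le> exp (Fbar R L bb b \<alpha> (ln s))" by simp
    also have "exp (F0 (ln s)) = (tail_gf s - 1) / k" using pos s by (simp add: F0_def)
    finally show ?thesis using k(1) by (simp add: field_simps k_def)
  qed
  have "exp (Fbar R L bb b \<alpha> (ln \<rho>)) \<le> exp (ln (1 + d))" using level[of \<rho>] r \<rho> by simp
  hence "k * (exp (Fbar R L bb b \<alpha> (ln \<rho>)) - 1) \<le> k * d" using d k by (intro mult_left_mono) auto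
  hence gap: "tail_gf \<rho> - mean \<le> (1 - b) * D b ((mean - 1) / (1 - b))"
    using le[of \<rho>] \<rho>J r \<rho> d by (simp add: mean \<alpha>[symmetric])
  note kendall = kendall_renewal_bound[OF b p1 u_0 u_rec gap, of z, unfolded mean, folded \<alpha>]
  show "summable (\<lambda>n. of_real (u n - 1 / m) * z ^ n)"
    using kendall(1) r \<rho> z by simp
  define E where "E = r powr kappa R L bb b \<alpha> r"
  define T where "T = tail_gf r - m"
  have E: "E = exp (Fbar R L bb b \<alpha> (ln r))" using r by (simp add: E_def kappa_def powr_def)
  have "E < exp (ln (1 + d))" unfolding E using level[of r] r by simp
  hence E_lt: "0 < d - E + 1" using d by simp
  have T_le: "T \<le> k * (E - 1)" unfolding T_def E using le[of r] r \<rho> rJ by simp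
  have T_pos: "0 < T" using tail_gf_strict_mono[of 1 r] r \<rho> p1 by (simp add: T_def tail_gf_1 mean)
  have "k * (d - E + 1) \<le> k * d - T" using T_le by (simp add: algebra_simps)
  have "cmod (\<Sum>n. of_real (u n - 1 / m) * z ^ n) \<le> T / (m * (r - 1) * (k * d - T))"
    using kendall(2) r \<rho> z by (simp add: T_def d)
  also have "\<dots> \<le> (k * (E - 1)) / (m * (r - 1) * (k * (d - E + 1)))"
    using T_le T_pos \<open>k * (d - E + 1) \<le> k * d - T\<close> E_lt k m1 r
    by (intro frac_le mult_left_mono mult_pos_pos) auto
  also have "\<dots> = (1 / m) * (E - 1) / ((r - 1) * (d - E + 1))"
    using k(1) by (simp add: mult_ac)
  finally show "cmod (\<Sum>n. of_real (u n - 1 / m) * z ^ n)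
           \<le> (1 / m) * (r powr kappa R L bb b \<alpha> r - 1)
               / ((r - 1) * (D b \<alpha> / \<alpha> - r powr kappa R L bb b \<alpha> r + 1))"
    by (simp only: E_def d_def)
qed

section \<open>One-step laws of the split chain\<close>
locale atomic_split_chain =
  drift_chain S P \<pi> C bb \<nu> V lam K b + split_chain M S P C bb \<nu> X Y a 1
  for S :: "'a measure" and P :: "'a \<Rightarrow> 'a measure" and \<pi> :: "'a measure"
    and C :: "'a set" and bb :: real and \<nu> :: "'a measure"
    and V :: "'a \<Rightarrow> real" and lam K b :: real
    and M :: "'w measure" and X :: "nat \<Rightarrow> 'w \<Rightarrow> 'a" and Y :: "nat \<Rightarrow> 'w \<Rightarrow> nat" and a :: 'a +
  assumes a_in_C: "a \<in> C"
begin

abbreviation hist :: "nat \<Rightarrow> nat \<Rightarrow> 'w measure" where "hist n m \<equiv> history M S X Y n m"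

definition hits :: "nat \<Rightarrow> 'a set \<Rightarrow> 'w set" where "hits n A = X n -` A \<inter> space M"

definition renewed :: "nat \<Rightarrow> 'w set" where "renewed n = {\<omega>\<in>space M. Y n \<omega> = 1}"

lemma hits_events [measurable, simp]: "A \<in> sets S \<Longrightarrow> hits n A \<in> sets M"
  unfolding hits_def using X_measurable by (rule measurable_sets)

lemma renewed_eq: "renewed n = Y n -` {1} \<inter> space M" by (auto simp: renewed_def)

lemma renewed_events [measurable, simp]: "renewed n \<in> sets M"
  unfolding renewed_eq using Y_measurable by (rule measurable_sets) simp

lemma space_hist [simp]: "space (hist n m) = space M"
  by (simp add: history_def space_measure_of_conv)

lemma sets_hist: "sets (hist n m) = sigma_sets (space M)
     ((\<Union>i\<in>{..n}. {X i -` A \<inter> space M |A. A \<in> sets S}) \<union>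
      (\<Union>i\<in>{..<m}. {Y i -` B \<inter> space M |B. B \<subseteq> {0, 1}}))"
  unfolding history_def by (rule sets_measure_of) auto

lemma hist_subset_events: "sets (hist n m) \<subseteq> sets M"
  unfolding sets_hist
proof (rule sets.sigma_sets_subset, safe)
  fix i A assume "A \<in> sets S" thus "X i -` A \<inter> space M \<in> sets M"
    using measurable_sets[OF X_measurable] by blast
next
  fix i B assume "B \<subseteq> {0, 1::nat}" thus "Y i -` B \<inter> space M \<in> sets M"
    using measurable_sets[OF Y_measurable[of i], of B] by simp
qed

lemma hist_events: "E \<in> sets (hist n m) \<Longrightarrow> E \<in> sets M"
  using hist_subset_events by blast

lemma hist_mono: "n \<le> n' \<Longrightarrow> m \<le> m' \<Longrightarrow> sets (hist n m) \<subseteq> sets (hist n' m')"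
  unfolding sets_hist by (intro sigma_sets_mono' Un_mono UN_mono) auto

lemma hits_in_hist: "i \<le> n \<Longrightarrow> A \<in> sets S \<Longrightarrow> hits i A \<in> sets (hist n m)"
  unfolding sets_hist hits_def by (rule sigma_sets.Basic) auto

lemma renewed_in_hist: "i < m \<Longrightarrow> renewed i \<in> sets (hist n m)"
  unfolding sets_hist renewed_eq by (intro sigma_sets.Basic UnI2 UN_I[of i]) auto

lemma X_measurable_hist: "X n \<in> hist n m \<rightarrow>\<^sub>M S"
proof (rule measurableI)
  fix A assume "A \<in> sets S"
  thus "X n -` A \<inter> space (hist n m) \<in> sets (hist n m)"
    using hits_in_hist[of n n A m] by (simp add: hits_def)
qed (use measurable_space[OF X_measurable] in auto)

lemma finite_measure_subalgebra_hist: "finite_measure_subalgebra M (hist n m)"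
  by unfold_locales (use hist_subset_events in \<open>auto simp: subalgebra_def\<close>)

text \<open>
  Conditional probabilities are used in integrated form, tested against bounded functions of the
  history.
\<close>
lemma integral_cond_exp_indicator:
  assumes g: "g \<in> borel_measurable (hist n m)" "\<And>\<omega>. \<bar>g \<omega>\<bar> \<le> B" and E: "E \<in> sets M"
    and f: "AE \<omega> in M. real_cond_exp M (hist n m) (\<lambda>\<omega>. indicator E \<omega>) \<omega> = f \<omega>" 
    and fm: "f \<in> borel_measurable M"
  shows "(\<integral>\<omega>. g \<omega> * indicator E \<omega> \<partial>M) = (\<integral>\<omega>. g \<omega> * f \<omega> \<partial>M)"
proof -
  interpret H: finite_measure_subalgebra M "hist n m" by (rule finite_measure_subalgebra_hist)
  have gM: "g \<in> borel_measurable M" using g(1) H.subalg by (rule measurable_from_subalg[rotated])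
  have "integrable M (\<lambda>\<omega>. g \<omega> * indicator E \<omega>)"
    by (rule integrable_const_bound[of _ B]) 
       (use g(2) gM E order_trans[OF abs_ge_zero g(2)] in \<open>auto simp: indicator_def intro!: AE_I2\<close>)
  hence "(\<integral>\<omega>. g \<omega> * indicator E \<omega> \<partial>M) = (\<integral>\<omega>. g \<omega> * real_cond_exp M (hist n m) (\<lambda>\<omega>. indicator E \<omega>) \<omega> \<partial>M)"
    using g(1) E by (intro H.real_cond_exp_intg(2)[symmetric]) auto
  also have "\<dots> = (\<integral>\<omega>. g \<omega> * f \<omega> \<partial>M)"
    using f gM fm by (intro integral_cong_AE) auto
  finally show ?thesis .
qed

lemma prob_space_P: "x \<in> space S \<Longrightarrow> prob_space (P x)" and sets_P: "x \<in> space S \<Longrightarrow> sets (P x) = sets S"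
  using measurable_space[OF kernel, of x] by (auto simp: space_prob_algebra)

lemma measurable_P [measurable]: "P \<in> S \<rightarrow>\<^sub>M subprob_algebra S"
  using kernel by (rule measurable_prob_algebraD)

lemma measurable_measure_P [measurable]: "A \<in> sets S \<Longrightarrow> (\<lambda>x. measure (P x) A) \<in> borel_measurable S"
  using measurable_compose[OF measurable_P measurable_measure_subprob_algebra[of A S]] by simp

lemma measurable_C [measurable]: "C \<in> sets S" by (rule C_sets)

lemma X_space: "\<omega> \<in> space M \<Longrightarrow> X n \<omega> \<in> space S"
  using measurable_space[OF X_measurable] by blast

lemma measurable_X [measurable]: "X n \<in> M \<rightarrow>\<^sub>M S" by (rule X_measurable)

lemma bounded_integrable: "f \<in> borel_measurable M \<Longrightarrow> (\<And>\<omega>. \<omega> \<in> space M \<Longrightarrow> \<bar>f \<omega>\<bar> \<le> B) \<Longrightarrow> integrable M (f :: 'w \<Rightarrow> real)"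
  by (rule integrable_const_bound[of _ B]) (auto intro!: AE_I2)

lemma indicator_renewed: "\<omega> \<in> space M \<Longrightarrow> indicator {1} (Y n \<omega>) = (indicator (renewed n) \<omega> :: real)"
  by (auto simp: renewed_def indicator_def)

lemma integral_renewed:
  assumes "1 \<le> n" and g: "g \<in> borel_measurable (hist n n)" "\<And>\<omega>. \<bar>g \<omega>\<bar> \<le> B"
  shows "(\<integral>\<omega>. g \<omega> * indicator (renewed n) \<omega> \<partial>M) = (\<integral>\<omega>. g \<omega> * (bb * indicator C (X n \<omega>)) \<partial>M)"
proof (rule integral_cond_exp_indicator[OF g])
  interpret H: finite_measure_subalgebra M "hist n n" by (rule finite_measure_subalgebra_hist)
  have "AE \<omega> in M. real_cond_exp M (hist n n) (\<lambda>\<omega>. indicator (renewed n) \<omega>) \<omega>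
      = real_cond_exp M (hist n n) (\<lambda>\<omega>. indicator {1} (Y n \<omega>)) \<omega>"
  proof (rule H.real_cond_exp_cong)
    have "(\<lambda>\<omega>. indicator {1} (Y n \<omega>) :: real) \<in> borel_measurable M 
        \<longleftrightarrow> (\<lambda>\<omega>. indicator (renewed n) \<omega> :: real) \<in> borel_measurable M"
      by (rule measurable_cong) (rule indicator_renewed)
    thus "(\<lambda>\<omega>. indicator {1} (Y n \<omega>) :: real) \<in> borel_measurable M" by simp
    show "AE \<omega> in M. indicator (renewed n) \<omega> = (indicator {1} (Y n \<omega>) :: real)"
      by (rule AE_I2) (simp only: indicator_renewed)
    show "(\<lambda>\<omega>. indicator (renewed n) \<omega> :: real) \<in> borel_measurable M" by simp
  qed
  with Y_law[OF assms(1)] show "AE \<omega> in M. real_cond_exp M (hist n n) (\<lambda>\<omega>. indicator (renewed n) \<omega>) \<omega> = bb * indicator C (X n \<omega>)"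
    by eventually_elim simp
qed auto

lemma prob_renewed:
  assumes "1 \<le> n" and E: "E \<in> sets (hist n n)"
  shows "prob (E \<inter> renewed n) = bb * prob (E \<inter> hits n C)"
proof -
  have EM[measurable]: "E \<in> sets M" by (rule hist_events[OF E])
  have "(\<integral>\<omega>. indicator E \<omega> * indicator (renewed n) \<omega> \<partial>M) = (\<integral>\<omega>. indicator E \<omega> * (bb * indicator C (X n \<omega>)) \<partial>M)"
    using E by (intro integral_renewed[OF assms(1), of _ 1]) (auto simp: indicator_def)
  moreover have "(\<integral>\<omega>. indicator E \<omega> * indicator (renewed n) \<omega> \<partial>M) = prob (E \<inter> renewed n)"
    by (simp add: indicator_inter_arith[symmetric])
  moreover have "(\<integral>\<omega>. indicator E \<omega> * (bb * indicator C (X n \<omega>)) \<partial>M) = (\<integral>\<omega>. bb * indicator (E \<inter> hits n C) \<omega> \<partial>M)"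
    by (intro Bochner_Integration.integral_cong) (auto simp: indicator_def hits_def)
  ultimately show ?thesis by simp
qed

text \<open>
  The law of the next state when no renewal takes place: the part of \<open>P x\<close> that is left after the
  removal of the minorizing mass.
\<close>
definition residual :: "'a set \<Rightarrow> 'a \<Rightarrow> real" where
  "residual A x = (measure (P x) A - bb * indicator C x * measure \<nu> A) / (1 - bb * indicator C x)"

lemma measurable_residual [measurable]: "A \<in> sets S \<Longrightarrow> residual A \<in> borel_measurable S"
  unfolding residual_def[abs_def]
  by (intro borel_measurable_divide borel_measurable_diff borel_measurable_times borel_measurable_const
        borel_measurable_indicator measurable_measure_P C_sets)

lemma residual_mixture:
  "residual A x + (measure \<nu> A - residual A x) * (bb * indicator C x) = measure (P x) A"
proof -
  define c where "c = bb * indicator C x"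
  have "1 - c \<noteq> 0" using bb_pos bb_less_1 by (auto simp: c_def indicator_def)
  hence "residual A x * (1 - c) = measure (P x) A - c * measure \<nu> A"
    by (simp add: residual_def c_def)
  thus ?thesis unfolding c_def[symmetric] by (simp add: algebra_simps)
qed

lemma residual_bound: "x \<in> space S \<Longrightarrow> \<bar>residual A x\<bar> \<le> 2 / (1 - bb)"
proof -
  assume x: "x \<in> space S"
  interpret Px: prob_space "P x" by (rule prob_space_P[OF x])
  interpret N: prob_space \<nu> by (rule prob_nu)
  have "0 \<le> bb * (indicator C x * measure \<nu> A)" "bb * (indicator C x * measure \<nu> A) \<le> 1"
    using bb_pos bb_less_1 by (auto simp: indicator_def mult_le_one)
  hence num: "\<bar>measure (P x) A - bb * (indicator C x * measure \<nu> A)\<bar> \<le> 2"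
    using Px.prob_le_1[of A] measure_nonneg[of "P x" A] by linarith
  have den: "1 - bb \<le> 1 - bb * indicator C x" "0 < 1 - bb"
    using bb_pos bb_less_1 by (auto simp: indicator_def)
  show ?thesis unfolding residual_def abs_divide using num den
    by (intro frac_le) (auto simp: mult.assoc)
qed

lemma integral_hits:
  assumes A: "A \<in> sets S" and g: "g \<in> borel_measurable (hist n (Suc n))" "\<And>\<omega>. \<bar>g \<omega>\<bar> \<le> B"
  shows "(\<integral>\<omega>. g \<omega> * indicator (hits (Suc n) A) \<omega> \<partial>M)
           = (\<integral>\<omega>. g \<omega> * (indicator (renewed n) \<omega> * measure \<nu> A 
                + (1 - indicator (renewed n) \<omega>) * residual A (X n \<omega>)) \<partial>M)"
proof (rule integral_cond_exp_indicator[OF g])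
  interpret H: finite_measure_subalgebra M "hist n (Suc n)" by (rule finite_measure_subalgebra_hist)
  note A[measurable]
  have ind: "indicator A (X (Suc n) \<omega>) = (indicator (hits (Suc n) A) \<omega> :: real)" if "\<omega> \<in> space M" for \<omega>
    using that by (auto simp: hits_def indicator_def)
  have "AE \<omega> in M. real_cond_exp M (hist n (Suc n)) (\<lambda>\<omega>. indicator (hits (Suc n) A) \<omega>) \<omega>
      = real_cond_exp M (hist n (Suc n)) (\<lambda>\<omega>. indicator A (X (Suc n) \<omega>)) \<omega>"
    by (rule H.real_cond_exp_cong) (auto simp: ind)
  with X_law[OF A, of n] AE_space
  show "AE \<omega> in M. real_cond_exp M (hist n (Suc n)) (\<lambda>\<omega>. indicator (hits (Suc n) A) \<omega>) \<omega>
     = indicator (renewed n) \<omega> * measure \<nu> A + (1 - indicator (renewed n) \<omega>) * residual A (X n \<omega>)"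
    by eventually_elim (auto simp: renewed_def residual_def indicator_def)
  show "(\<lambda>\<omega>. indicator (renewed n) \<omega> * measure \<nu> A
                + (1 - indicator (renewed n) \<omega>) * residual A (X n \<omega>)) \<in> borel_measurable M"
    by measurable
qed (use A in auto)

lemma prob_hits_after_renewal:
  assumes E: "E \<in> sets (hist n (Suc n))" "E \<subseteq> renewed n" and A: "A \<in> sets S"
  shows "prob (E \<inter> hits (Suc n) A) = prob E * measure \<nu> A"
proof -
  note A[measurable]
  have EM[measurable]: "E \<in> sets M" by (rule hist_events[OF E(1)])
  have "prob (E \<inter> hits (Suc n) A) = (\<integral>\<omega>. indicator E \<omega> * indicator (hits (Suc n) A) \<omega> \<partial>M)"
    by (simp add: indicator_inter_arith[symmetric])
  also have "\<dots> = (\<integral>\<omega>. indicator E \<omega> * (indicator (renewed n) \<omega> * measure \<nu> A 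
                + (1 - indicator (renewed n) \<omega>) * residual A (X n \<omega>)) \<partial>M)"
    using E by (intro integral_hits[OF A, of _ _ 1]) (auto simp: indicator_def)
  also have "\<dots> = (\<integral>\<omega>. indicator E \<omega> * measure \<nu> A \<partial>M)"
    using E(2) by (intro Bochner_Integration.integral_cong) (auto simp: indicator_def)
  finally show ?thesis by simp
qed

text \<open>
  Mixing the residual law and \<open>\<nu>\<close> with the renewal probability \<open>bb * indicator C\<close> gives back \<open>P\<close>.  So
  conditionally on the states up to \<open>n\<close> and on the marks before \<open>n\<close>, the first coordinate moves
  according to \<open>P\<close>.  The restriction \<open>1 \<le> n\<close> comes from the prescribed mark at time \<open>0\<close>.
\<close>
lemma prob_hits_step:
  assumes n: "1 \<le> n" and E: "E \<in> sets (hist n n)" and A: "A \<in> sets S"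
  shows "prob (E \<inter> hits (Suc n) A) = (\<integral>\<omega>. indicator E \<omega> * measure (P (X n \<omega>)) A \<partial>M)"
proof -
  note A[measurable]
  have EM[measurable]: "E \<in> sets M" by (rule hist_events[OF E])
  have E': "E \<in> sets (hist n (Suc n))" using E hist_mono[of n n n "Suc n"] by auto
  interpret N: prob_space \<nu> by (rule prob_nu)
  \<comment> \<open>The bound for \<open>residual\<close> holds for states only, hence \<open>g'\<close> is cut off outside the sample space.\<close>
  define g where "g = (\<lambda>\<omega>. indicator E \<omega> * (measure \<nu> A - residual A (X n \<omega>)))"
  define g' where "g' = (\<lambda>\<omega>. if \<omega> \<in> space M then g \<omega> else 0)"
  have g'_bound: "\<bar>g' \<omega>\<bar> \<le> 1 + 2 / (1 - bb)" for \<omega>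
  proof (cases "\<omega> \<in> space M")
    case True
    have "\<bar>g \<omega>\<bar> \<le> \<bar>measure \<nu> A - residual A (X n \<omega>)\<bar>" by (auto simp: g_def indicator_def)
    also have "\<dots> \<le> 1 + 2 / (1 - bb)"
      using residual_bound[OF X_space[OF True], of A n] N.prob_le_1[of A] measure_nonneg[of \<nu> A] by linarith
    finally show ?thesis using True by (simp add: g'_def)
  qed (use bb_less_1 in \<open>simp add: g'_def\<close>)
  have "g \<in> borel_measurable (hist n n)" unfolding g_def
    using E measurable_compose[OF X_measurable_hist[of n n] measurable_residual[OF A]] by measurable
  hence g'_meas: "g' \<in> borel_measurable (hist n n)"
    by (subst measurable_cong[where g = g]) (auto simp: g'_def)
  have int_res: "integrable M (\<lambda>\<omega>. indicator E \<omega> * residual A (X n \<omega>))"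
    by (rule bounded_integrable[of _ "2 / (1 - bb)"])
       (use residual_bound X_space bb_less_1 in \<open>auto simp: indicator_def\<close>)
  have g'_M[measurable]: "g' \<in> borel_measurable M"
    unfolding g'_def g_def by measurable
  have int_g1: "integrable M (\<lambda>\<omega>. g' \<omega> * indicator (renewed n) \<omega>)"
    by (rule bounded_integrable[of _ "1 + 2 / (1 - bb)"]) 
       (use g'_bound bb_less_1 in \<open>auto simp: indicator_def\<close>)
  have int_g2: "integrable M (\<lambda>\<omega>. g' \<omega> * (bb * indicator C (X n \<omega>)))"
  proof (rule bounded_integrable[of _ "1 + 2 / (1 - bb)"])
    fix \<omega> 
    have "\<bar>g' \<omega>\<bar> * \<bar>bb * indicator C (X n \<omega>)\<bar> \<le> (1 + 2 / (1 - bb)) * 1"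
      using g'_bound[of \<omega>] bb_pos bb_less_1 by (intro mult_mono) (auto simp: indicator_def)
    thus "\<bar>g' \<omega> * (bb * indicator C (X n \<omega>))\<bar> \<le> 1 + 2 / (1 - bb)" by (simp add: abs_mult)
  qed measurable
  have "prob (E \<inter> hits (Suc n) A) = (\<integral>\<omega>. indicator E \<omega> * indicator (hits (Suc n) A) \<omega> \<partial>M)"
    by (simp add: indicator_inter_arith[symmetric])
  also have "\<dots> = (\<integral>\<omega>. indicator E \<omega> * (indicator (renewed n) \<omega> * measure \<nu> A 
                + (1 - indicator (renewed n) \<omega>) * residual A (X n \<omega>)) \<partial>M)"
    using E' by (intro integral_hits[OF A, of _ _ 1]) (auto simp: indicator_def)
  also have "\<dots> = (\<integral>\<omega>. indicator E \<omega> * residual A (X n \<omega>) + g' \<omega> * indicator (renewed n) \<omega> \<partial>M)"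
    by (intro Bochner_Integration.integral_cong) (auto simp: g'_def g_def indicator_def)
  also have "\<dots> = (\<integral>\<omega>. indicator E \<omega> * residual A (X n \<omega>) \<partial>M) + (\<integral>\<omega>. g' \<omega> * indicator (renewed n) \<omega> \<partial>M)"
    by (rule Bochner_Integration.integral_add[OF int_res int_g1])
  also have "(\<integral>\<omega>. g' \<omega> * indicator (renewed n) \<omega> \<partial>M) = (\<integral>\<omega>. g' \<omega> * (bb * indicator C (X n \<omega>)) \<partial>M)"
    by (rule integral_renewed[OF n g'_meas g'_bound])
  also have "(\<integral>\<omega>. indicator E \<omega> * residual A (X n \<omega>) \<partial>M) + (\<integral>\<omega>. g' \<omega> * (bb * indicator C (X n \<omega>)) \<partial>M)
      = (\<integral>\<omega>. indicator E \<omega> * residual A (X n \<omega>) + g' \<omega> * (bb * indicator C (X n \<omega>)) \<partial>M)"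
    by (rule Bochner_Integration.integral_add[OF int_res int_g2, symmetric])
  also have "\<dots> = (\<integral>\<omega>. indicator E \<omega> * measure (P (X n \<omega>)) A \<partial>M)"
  proof (intro Bochner_Integration.integral_cong refl)
    fix \<omega> assume "\<omega> \<in> space M"
    hence "indicator E \<omega> * residual A (X n \<omega>) + g' \<omega> * (bb * indicator C (X n \<omega>)) 
        = indicator E \<omega> * (residual A (X n \<omega>) + (measure \<nu> A - residual A (X n \<omega>)) * (bb * indicator C (X n \<omega>)))"
      by (simp add: g'_def g_def algebra_simps)
    thus "indicator E \<omega> * residual A (X n \<omega>) + g' \<omega> * (bb * indicator C (X n \<omega>)) = indicator E \<omega> * measure (P (X n \<omega>)) A"
      by (simp only: residual_mixture)
  qed
  finally show ?thesis .
qed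

lemma nn_integral_step:
  assumes n: "1 \<le> n" and E: "E \<in> sets (hist n n)" and f[measurable]: "f \<in> borel_measurable S"
  shows "(\<integral>\<^sup>+\<omega>. f (X (Suc n) \<omega>) * indicator E \<omega> \<partial>M) = (\<integral>\<^sup>+\<omega>. (\<integral>\<^sup>+y. f y \<partial>P (X n \<omega>)) * indicator E \<omega> \<partial>M)"
proof -
  have EM[measurable]: "E \<in> sets M" by (rule hist_events[OF E])
  define N where "N k = distr (density M (indicator E)) S (X k)" for k
  have sets_N: "sets (N k) = sets S" and space_N: "space (N k) = space S" for k by (auto simp: N_def)
  have int_N: "(\<integral>\<^sup>+x. h x \<partial>N k) = (\<integral>\<^sup>+\<omega>. h (X k \<omega>) * indicator E \<omega> \<partial>M)" 
    if [measurable]: "h \<in> borel_measurable S" for h :: "'a \<Rightarrow> ennreal" and k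
    unfolding N_def by (simp add: nn_integral_distr nn_integral_density mult.commute)
  have ne: "space (N n) \<noteq> {}" using not_empty X_space unfolding space_N by blast
  have PN: "P \<in> N n \<rightarrow>\<^sub>M subprob_algebra S" 
    using measurable_P by (simp add: measurable_cong_sets[OF sets_N refl])
  have "N (Suc n) = N n \<bind> P"
  proof (rule measure_eqI)
    show "sets (N (Suc n)) = sets (N n \<bind> P)"
      using ne by (subst sets_bind) (auto simp: sets_N space_N sets_P)
    fix A assume "A \<in> sets (N (Suc n))"
    hence A[measurable]: "A \<in> sets S" by (simp add: sets_N)
    have "emeasure (N (Suc n)) A = (\<integral>\<^sup>+x. indicator A x \<partial>N (Suc n))" by (simp add: sets_N)
    also have "\<dots> = (\<integral>\<^sup>+\<omega>. indicator A (X (Suc n) \<omega>) * indicator E \<omega> \<partial>M)" by (rule int_N) measurable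
    also have "\<dots> = (\<integral>\<^sup>+\<omega>. indicator (E \<inter> hits (Suc n) A) \<omega> \<partial>M)"
      by (intro nn_integral_cong) (auto simp: indicator_def hits_def)
    also have "\<dots> = ennreal (prob (E \<inter> hits (Suc n) A))" 
      by (simp add: emeasure_eq_measure)
    also have "\<dots> = ennreal (\<integral>\<omega>. indicator E \<omega> * measure (P (X n \<omega>)) A \<partial>M)"
      by (simp only: prob_hits_step[OF n E A])
    also have "\<dots> = (\<integral>\<^sup>+\<omega>. ennreal (indicator E \<omega> * measure (P (X n \<omega>)) A) \<partial>M)"
    proof (rule nn_integral_eq_integral[symmetric])
      show "integrable M (\<lambda>\<omega>. indicator E \<omega> * measure (P (X n \<omega>)) A)"
      proof (rule bounded_integrable[of _ 1])
        fix \<omega> assume "\<omega> \<in> space M"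
        interpret Px: prob_space "P (X n \<omega>)" by (rule prob_space_P[OF X_space[OF \<open>\<omega> \<in> space M\<close>]])
        show "\<bar>indicator E \<omega> * measure (P (X n \<omega>)) A\<bar> \<le> 1" by (simp add: indicator_def)
      qed measurable
    qed simp
    also have "\<dots> = (\<integral>\<^sup>+\<omega>. emeasure (P (X n \<omega>)) A * indicator E \<omega> \<partial>M)"
    proof (rule nn_integral_cong)
      fix \<omega> assume "\<omega> \<in> space M"
      interpret Px: prob_space "P (X n \<omega>)" by (rule prob_space_P[OF X_space[OF \<open>\<omega> \<in> space M\<close>]])
      show "ennreal (indicator E \<omega> * measure (P (X n \<omega>)) A) = emeasure (P (X n \<omega>)) A * indicator E \<omega>"
        by (simp add: Px.emeasure_eq_measure indicator_def)
    qed
    also have "\<dots> = (\<integral>\<^sup>+x. emeasure (P x) A \<partial>N n)" 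
      by (rule int_N[symmetric]) measurable
    also have "\<dots> = emeasure (N n \<bind> P) A" by (rule emeasure_bind[OF ne PN A, symmetric])
    finally show "emeasure (N (Suc n)) A = emeasure (N n \<bind> P) A" .
  qed
  hence "(\<integral>\<^sup>+x. f x \<partial>N (Suc n)) = (\<integral>\<^sup>+x. \<integral>\<^sup>+y. f y \<partial>P x \<partial>N n)"
    using nn_integral_bind[OF f PN] by simp
  thus ?thesis by (subst (asm) (1 2) int_N) measurable
qed

lemma nn_integral_after_renewal:
  assumes E: "E \<in> sets (hist n (Suc n))" "E \<subseteq> renewed n" and f[measurable]: "f \<in> borel_measurable S"
  shows "(\<integral>\<^sup>+\<omega>. f (X (Suc n) \<omega>) * indicator E \<omega> \<partial>M) = emeasure M E * (\<integral>\<^sup>+y. f y \<partial>\<nu>)"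
proof -
  have EM[measurable]: "E \<in> sets M" by (rule hist_events[OF E(1)])
  interpret N: prob_space \<nu> by (rule prob_nu)
  define N where "N = distr (density M (indicator E)) S (X (Suc n))"
  have int_N: "(\<integral>\<^sup>+x. h x \<partial>N) = (\<integral>\<^sup>+\<omega>. h (X (Suc n) \<omega>) * indicator E \<omega> \<partial>M)" 
    if [measurable]: "h \<in> borel_measurable S" for h :: "'a \<Rightarrow> ennreal"
    unfolding N_def by (simp add: nn_integral_distr nn_integral_density mult.commute)
  have "N = scale_measure (emeasure M E) \<nu>"
  proof (rule measure_eqI)
    fix A assume "A \<in> sets N"
    hence A[measurable]: "A \<in> sets S" by (simp add: N_def)
    have "emeasure N A = (\<integral>\<^sup>+x. indicator A x \<partial>N)" by (simp add: N_def)
    also have "\<dots> = (\<integral>\<^sup>+\<omega>. indicator A (X (Suc n) \<omega>) * indicator E \<omega> \<partial>M)" by (rule int_N) measurable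
    also have "\<dots> = (\<integral>\<^sup>+\<omega>. indicator (E \<inter> hits (Suc n) A) \<omega> \<partial>M)"
      by (intro nn_integral_cong) (auto simp: indicator_def hits_def)
    also have "\<dots> = ennreal (prob (E \<inter> hits (Suc n) A))" 
      by (simp add: emeasure_eq_measure)
    also have "\<dots> = emeasure (scale_measure (emeasure M E) \<nu>) A"
      by (simp add: prob_hits_after_renewal[OF E A] emeasure_eq_measure N.emeasure_eq_measure ennreal_mult)
    finally show "emeasure N A = emeasure (scale_measure (emeasure M E) \<nu>) A" .
  qed (simp add: N_def sets_nu)
  moreover have "f \<in> borel_measurable \<nu>" using f by (simp add: measurable_cong_sets[OF sets_nu refl])
  ultimately show ?thesis using int_N[OF f] by (simp add: nn_integral_scale_measure)
qed

section \<open>The renewal equation\<close>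
lemma in_hist_mono: "E \<in> sets (hist n m) \<Longrightarrow> n \<le> n' \<Longrightarrow> m \<le> m' \<Longrightarrow> E \<in> sets (hist n' m')"
  using hist_mono by blast

text \<open>
  The probability that a \<open>P\<close>-chain now at \<open>x\<close> renews in \<open>m\<close> steps, that is \<open>P\<^sup>m (bb 1\<^sub>C)\<close> at \<open>x\<close>.
\<close>
primrec renewal_chance :: "nat \<Rightarrow> 'a \<Rightarrow> ennreal" where
  "renewal_chance 0 x = ennreal bb * indicator C x"
| "renewal_chance (Suc m) x = (\<integral>\<^sup>+y. renewal_chance m y \<partial>P x)"

lemma measurable_renewal_chance [measurable]: "renewal_chance m \<in> borel_measurable S"
proof (induction m)
  case 0
  have "(\<lambda>x. ennreal bb * indicator C x) \<in> borel_measurable S" by measurable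
  thus ?case by (simp cong: measurable_cong)
next
  case (Suc m)
  have "(\<lambda>x. \<integral>\<^sup>+y. renewal_chance m y \<partial>P x) \<in> borel_measurable S"
    using measurable_compose[OF measurable_P nn_integral_measurable_subprob_algebra[OF Suc]] .
  thus ?case by (simp cong: measurable_cong)
qed

lemma emeasure_renewed_later:
  assumes "1 \<le> n" "E \<in> sets (hist n n)"
  shows "emeasure M (E \<inter> renewed (n + m)) = (\<integral>\<^sup>+\<omega>. renewal_chance m (X n \<omega>) * indicator E \<omega> \<partial>M)"
  using assms
proof (induction m arbitrary: n)
  case (0 n)
  note [measurable] = hist_events[OF 0(2)]
  have "emeasure M (E \<inter> renewed n) = ennreal (bb * prob (E \<inter> hits n C))"
    by (simp add: emeasure_eq_measure prob_renewed[OF 0])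
  also have "\<dots> = ennreal bb * emeasure M (E \<inter> hits n C)"
    using bb_pos by (simp add: emeasure_eq_measure ennreal_mult)
  also have "\<dots> = (\<integral>\<^sup>+\<omega>. ennreal bb * indicator (E \<inter> hits n C) \<omega> \<partial>M)"
    by (simp add: nn_integral_cmult C_sets)
  also have "\<dots> = (\<integral>\<^sup>+\<omega>. renewal_chance 0 (X n \<omega>) * indicator E \<omega> \<partial>M)"
    by (intro nn_integral_cong) (auto simp: indicator_def hits_def)
  finally show ?case by simp
next
  case (Suc m n)
  have E': "E \<in> sets (hist (Suc n) (Suc n))"
    using Suc.prems(2) by (rule in_hist_mono) auto
  have "emeasure M (E \<inter> renewed (n + Suc m)) = (\<integral>\<^sup>+\<omega>. renewal_chance m (X (Suc n) \<omega>) * indicator E \<omega> \<partial>M)"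
    using Suc.IH[OF _ E'] by simp
  also have "\<dots> = (\<integral>\<^sup>+\<omega>. renewal_chance (Suc m) (X n \<omega>) * indicator E \<omega> \<partial>M)"
    by (simp add: nn_integral_step[OF Suc.prems])
  finally show ?case .
qed

text \<open>
  Regeneration: after a renewal the future forgets the event \<open>E\<close>.
\<close>
lemma emeasure_renewed_after_renewal:
  assumes "E \<in> sets (hist n (Suc n))" "E \<subseteq> renewed n"
  shows "emeasure M (E \<inter> renewed (Suc n + m)) = emeasure M E * (\<integral>\<^sup>+x. renewal_chance m x \<partial>\<nu>)"
proof -
  have "E \<in> sets (hist (Suc n) (Suc n))" using assms(1) by (rule in_hist_mono) auto
  thus ?thesis
    using emeasure_renewed_later[of "Suc n" E m] nn_integral_after_renewal[OF assms, of "renewal_chance m"] by simp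
qed

lemma AE_renewed_0: "AE \<omega> in M. \<omega> \<in> renewed 0"
  using Y_0 AE_space by eventually_elim (simp add: renewed_def)

lemma renewed_0_inter:
  assumes "E \<in> sets M"
  shows "emeasure M (renewed 0 \<inter> E) = emeasure M E"
proof (rule emeasure_eq_AE)
  show "AE \<omega> in M. \<omega> \<in> renewed 0 \<inter> E \<longleftrightarrow> \<omega> \<in> E"
    using AE_renewed_0 by eventually_elim simp
qed (use assms in simp_all)

lemma emeasure_renewed_0: "emeasure M (renewed 0) = 1"
proof -
  have "renewed 0 \<inter> space M = renewed 0" by (auto simp: renewed_def)
  thus ?thesis using renewed_0_inter[of "space M"] by (simp add: emeasure_space_1)
qed

abbreviation u :: "nat \<Rightarrow> real" where "u \<equiv> renewal_prob M Y"
abbreviation p :: "nat \<Rightarrow> real" where "p \<equiv> return_prob M Y"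

lemma u_eq: "u n = prob (renewed n)" by (simp add: renewal_prob_def renewed_def)

lemma u_0: "u 0 = 1" using emeasure_renewed_0 by (simp add: u_eq emeasure_eq_measure)

lemma u_Suc: "ennreal (u (Suc m)) = (\<integral>\<^sup>+x. renewal_chance m x \<partial>\<nu>)"
  using emeasure_renewed_after_renewal[of "renewed 0" 0 m] renewed_0_inter[of "renewed (Suc m)"] 
    renewed_in_hist[of 0 1 0] emeasure_renewed_0
  by (simp add: u_eq emeasure_eq_measure)

definition unreturned :: "nat \<Rightarrow> 'w set" where
  "unreturned n = {\<omega>\<in>space M. \<forall>k\<in>{1..<n}. Y k \<omega> \<noteq> 1}"

definition returned :: "nat \<Rightarrow> 'w set" where "returned n = unreturned n \<inter> renewed n"

lemma unreturned_in_hist: "unreturned n \<in> sets (hist k n)"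
proof -
  have "unreturned n = space (hist k n) - (\<Union>i\<in>{1..<n}. renewed i)"
    by (auto simp: unreturned_def renewed_def)
  also have "\<dots> \<in> sets (hist k n)"
    by (intro sets.Diff sets.top sets.finite_UN) (auto intro: renewed_in_hist)
  finally show ?thesis .
qed

lemma unreturned_events [measurable, simp]: "unreturned n \<in> sets M"
  using unreturned_in_hist by (rule hist_events)

lemma returned_events [measurable, simp]: "returned n \<in> sets M" by (simp add: returned_def)

lemma returned_in_hist: "returned n \<in> sets (hist k (Suc n))"
  unfolding returned_def
  by (intro sets.Int in_hist_mono[OF unreturned_in_hist] renewed_in_hist) auto

lemma unreturned_1: "unreturned (Suc 0) = space M" by (auto simp: unreturned_def)

lemma unreturned_Suc: "1 \<le> n \<Longrightarrow> unreturned n = unreturned (Suc n) \<union> returned n"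
  and unreturned_Suc_disjoint: "1 \<le> n \<Longrightarrow> unreturned (Suc n) \<inter> returned n = {}"
  by (auto simp: unreturned_def returned_def renewed_def atLeastLessThanSuc)

lemma first_return_eq_iff:
  "first_return Y \<omega> = enat n \<longleftrightarrow> 1 \<le> n \<and> Y n \<omega> = 1 \<and> (\<forall>k\<in>{1..<n}. Y k \<omega> \<noteq> 1)"
proof -
  define N where "N = {n. 1 \<le> n \<and> Y n \<omega> = 1}"
  have fr: "first_return Y \<omega> = (INF n\<in>N. enat n)" by (simp add: first_return_def N_def)
  have least: "first_return Y \<omega> = enat k" if "k \<in> N" "\<And>i. i \<in> N \<Longrightarrow> k \<le> i" for k
    unfolding fr using that by (intro antisym INF_lower INF_greatest) auto
  show ?thesis
  proof
    assume *: "first_return Y \<omega> = enat n"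
    have "N \<noteq> {}" using * by (auto simp: fr top_enat_def)
    then obtain j where "j \<in> N" by auto
    hence "(LEAST k. k \<in> N) \<in> N" "\<And>i. i \<in> N \<Longrightarrow> (LEAST k. k \<in> N) \<le> i"
      by (auto intro: LeastI Least_le)
    moreover from this have "n = (LEAST k. k \<in> N)" using least[of "LEAST k. k \<in> N"] * by simp
    ultimately have "n \<in> N" "\<And>i. i \<in> N \<Longrightarrow> n \<le> i" by auto
    thus "1 \<le> n \<and> Y n \<omega> = 1 \<and> (\<forall>k\<in>{1..<n}. Y k \<omega> \<noteq> 1)" by (fastforce simp: N_def)
  next
    assume *: "1 \<le> n \<and> Y n \<omega> = 1 \<and> (\<forall>k\<in>{1..<n}. Y k \<omega> \<noteq> 1)"
    show "first_return Y \<omega> = enat n"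
    proof (rule least)
      show "n \<in> N" using * by (simp add: N_def)
      show "n \<le> i" if "i \<in> N" for i
      proof (rule ccontr)
        assume "\<not> n \<le> i"
        hence "i \<in> {1..<n}" using that by (simp add: N_def)
        thus False using * that by (simp add: N_def)
      qed
    qed
  qed
qed

lemma p_eq: "1 \<le> n \<Longrightarrow> p n = prob (returned n)"
  unfolding return_prob_def first_return_eq_iff
  by (rule arg_cong[where f = prob]) (auto simp: returned_def unreturned_def renewed_def)

lemma p_0: "p 0 = 0" unfolding return_prob_def first_return_eq_iff by simp

lemma p_nonneg: "0 \<le> p n" by (simp add: return_prob_def)

text \<open>
  Decomposition according to the first return \<open>k \<le> n\<close>; the factor \<open>u (n - k)\<close> appears because both the chain
  started at the atom and the chain after the first return enter their next state with law \<open>\<nu>\<close>.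
\<close>
lemma renewal_equation:
  assumes "0 < n"
  shows "u n = (\<Sum>k=1..n. p k * u (n - k))"
proof -
  have "renewed n = (\<Union>k\<in>{1..n}. returned k \<inter> renewed n)"
  proof (intro equalityI subsetI)
    fix \<omega> assume \<omega>: "\<omega> \<in> renewed n"
    define k where "k = (LEAST k. 1 \<le> k \<and> Y k \<omega> = 1)"
    have ex: "1 \<le> n \<and> Y n \<omega> = 1" using \<omega> assms by (auto simp: renewed_def)
    have "1 \<le> k \<and> Y k \<omega> = 1" unfolding k_def by (rule LeastI[of _ n]) (rule ex)
    moreover have "k \<le> n" unfolding k_def by (rule Least_le) (rule ex)
    moreover have "Y i \<omega> \<noteq> 1" if "1 \<le> i" "i < k" for i
      using not_less_Least[of i "\<lambda>k. 1 \<le> k \<and> Y k \<omega> = 1"] that by (auto simp: k_def)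
    ultimately have "k \<in> {1..n}" "\<omega> \<in> returned k"
      using \<omega> by (auto simp: returned_def unreturned_def renewed_def)
    thus "\<omega> \<in> (\<Union>k\<in>{1..n}. returned k \<inter> renewed n)" using \<omega> by blast
  qed auto
  hence "u n = prob (\<Union>k\<in>{1..n}. returned k \<inter> renewed n)" by (simp add: u_eq)
  also have "\<dots> = (\<Sum>k=1..n. prob (returned k \<inter> renewed n))"
  proof (rule finite_measure_finite_Union)
    have "returned i \<inter> returned j = {}" if "1 \<le> i" "i < j" for i j
      using that by (auto simp: returned_def unreturned_def renewed_def)
    hence "returned i \<inter> returned j = {}" if "i \<in> {1..n}" "j \<in> {1..n}" "i \<noteq> j" for i j
      using that by (cases i j rule: linorder_cases) (auto simp: Int_commute)
    thus "disjoint_family_on (\<lambda>k. returned k \<inter> renewed n) {1..n}"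
      unfolding disjoint_family_on_def by blast
  qed auto
  also have "\<dots> = (\<Sum>k=1..n. p k * u (n - k))"
  proof (rule sum.cong[OF refl])
    fix k assume k: "k \<in> {1..n}"
    show "prob (returned k \<inter> renewed n) = p k * u (n - k)"
    proof (cases "k = n")
      case True
      have "returned n \<inter> renewed n = returned n" by (auto simp: returned_def)
      thus ?thesis using True k by (simp add: p_eq u_0)
    next
      case False
      define m where "m = n - Suc k"
      have n: "n = Suc k + m" "n - k = Suc m" using False k by (auto simp: m_def)
      have "ennreal (prob (returned k \<inter> renewed n)) = ennreal (prob (returned k)) * ennreal (u (Suc m))"
        unfolding u_Suc n(1) emeasure_eq_measure[symmetric]
        by (rule emeasure_renewed_after_renewal[OF returned_in_hist]) (auto simp: returned_def)
      hence "prob (returned k \<inter> renewed n) = prob (returned k) * u (Suc m)"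
        by (simp add: ennreal_mult[symmetric] u_eq)
      thus ?thesis using k n by (simp add: p_eq)
    qed
  qed
  finally show ?thesis .
qed

lemma p_1: "p 1 = bb * measure \<nu> C"
proof -
  interpret N: prob_space \<nu> by (rule prob_nu)
  have "ennreal (u 1) = (\<integral>\<^sup>+x. ennreal bb * indicator C x \<partial>\<nu>)" using u_Suc[of 0] by simp
  also have "\<dots> = ennreal (bb * measure \<nu> C)"
    using bb_pos C_sets nn_integral_cmult_indicator[of C \<nu> "ennreal bb"]
    by (simp add: sets_nu N.emeasure_eq_measure ennreal_mult)
  finally have "u 1 = bb * measure \<nu> C" using bb_pos by (simp add: u_eq)
  moreover have "u 1 = p 1" using renewal_equation[of 1] u_0 by simp
  ultimately show ?thesis by simp
qed

lemma p_1_less_1: "p 1 < 1"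
proof -
  interpret N: prob_space \<nu> by (rule prob_nu)
  have "bb * measure \<nu> C \<le> bb * 1" using bb_pos by (intro mult_left_mono N.prob_le_1) auto
  thus ?thesis using p_1 bb_less_1 by simp
qed

lemma prob_unreturned_Suc: "prob (unreturned (Suc n)) = 1 - (\<Sum>k\<le>n. p k)"
proof (induction n)
  case (Suc n)
  have "prob (unreturned (Suc (Suc n)) \<union> returned (Suc n))
          = prob (unreturned (Suc (Suc n))) + prob (returned (Suc n))"
    by (rule finite_measure_Union) (simp_all add: unreturned_Suc_disjoint)
  moreover have "unreturned (Suc n) = unreturned (Suc (Suc n)) \<union> returned (Suc n)"
    by (rule unreturned_Suc) simp
  ultimately have "prob (unreturned (Suc n)) = prob (unreturned (Suc (Suc n))) + prob (returned (Suc n))"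
    by (simp only:)
  thus ?case using Suc by (simp add: p_eq)
qed (simp add: unreturned_1 p_0 prob_space)

lemma p_Suc_eq: "p (Suc n) = bb * prob (unreturned (Suc n) \<inter> hits (Suc n) C)"
  using prob_renewed[of "Suc n" "unreturned (Suc n)"] unreturned_in_hist by (simp add: p_eq returned_def)

section \<open>Finite mean return time\<close>
lemma a_space: "a \<in> space S" using a_in_C sets.sets_into_space[OF C_sets] by blast

lemma K_ge_1: "1 \<le> K"
proof -
  interpret Pa: prob_space "P a" by (rule prob_space_P[OF a_space])
  have "space (P a) = space S" using sets_P[OF a_space] by (rule sets_eq_imp_space_eq)
  hence "(\<integral>\<^sup>+y. 1 \<partial>P a) \<le> (\<integral>\<^sup>+y. ennreal (V y) \<partial>P a)"
    using V_ge_1 by (intro nn_integral_mono) auto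
  also have "\<dots> \<le> ennreal K" using a_in_C by (rule drift_on_C)
  finally have "ennreal 1 \<le> ennreal K" by (simp add: Pa.emeasure_space_1)
  thus ?thesis by (subst (asm) ennreal_le_iff2) auto
qed

text \<open>
  At a point of \<open>C\<close>, the minorization bounds \<open>bb \<nu>(V)\<close> by \<open>PV \<le> K\<close>.
\<close>
lemma nu_V_le: "(\<integral>\<^sup>+y. ennreal (V y) \<partial>\<nu>) \<le> ennreal (K / bb)"
proof -
  interpret N: prob_space \<nu> by (rule prob_nu)
  interpret Pa: prob_space "P a" by (rule prob_space_P[OF a_space])
  have sets: "sets (scale_measure (ennreal bb) \<nu>) = sets (P a)" using sets_nu sets_P[OF a_space] by simp
  have "scale_measure (ennreal bb) \<nu> \<le> P a"
    unfolding le_measure[OF sets]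
  proof
    fix A
    show "emeasure (scale_measure (ennreal bb) \<nu>) A \<le> emeasure (P a) A"
    proof (cases "A \<in> sets S")
      case True
      thus ?thesis using minorization[OF a_in_C True] bb_pos
        by (simp add: N.emeasure_eq_measure Pa.emeasure_eq_measure ennreal_mult[symmetric])
    next
      case False
      thus ?thesis using sets_nu by (simp add: emeasure_notin_sets)
    qed
  qed
  hence "(\<integral>\<^sup>+y. ennreal (V y) \<partial>scale_measure (ennreal bb) \<nu>) \<le> (\<integral>\<^sup>+y. ennreal (V y) \<partial>P a)"
    using sets by (intro nn_integral_mono_measure)
  also have "\<dots> \<le> ennreal K" using a_in_C by (rule drift_on_C)
  finally have "ennreal bb * (\<integral>\<^sup>+y. ennreal (V y) \<partial>\<nu>) \<le> ennreal K"
    using V_measurable by (subst (asm) nn_integral_scale_measure) (auto simp: measurable_cong_sets[OF sets_nu refl])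
  hence "ennreal (1 / bb) * (ennreal bb * (\<integral>\<^sup>+y. ennreal (V y) \<partial>\<nu>)) \<le> ennreal (1 / bb) * ennreal K"
    by (rule mult_left_mono) simp
  thus ?thesis using bb_pos K_ge_1 by (simp add: mult.assoc[symmetric] ennreal_mult[symmetric])
qed

text \<open>
  The expected value of \<open>V\<close> at time \<open>n + 1\<close>, on the event that there was no return up to time \<open>n\<close>.
\<close>
definition excursion_V :: "nat \<Rightarrow> ennreal" where
  "excursion_V n = (\<integral>\<^sup>+\<omega>. ennreal (V (X (Suc n) \<omega>)) * indicator (unreturned (Suc n)) \<omega> \<partial>M)"

lemma measurable_V [measurable]: "V \<in> borel_measurable S" by (rule V_measurable)

lemma excursion_V_0: "excursion_V 0 \<le> ennreal (K / bb)"
proof -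
  have "excursion_V 0 = (\<integral>\<^sup>+\<omega>. ennreal (V (X (Suc 0) \<omega>)) * indicator (renewed 0) \<omega> \<partial>M)"
    unfolding excursion_V_def
  proof (rule nn_integral_cong_AE)
    show "AE \<omega> in M. ennreal (V (X (Suc 0) \<omega>)) * indicator (unreturned (Suc 0)) \<omega>
        = ennreal (V (X (Suc 0) \<omega>)) * indicator (renewed 0) \<omega>"
      using AE_renewed_0 AE_space by eventually_elim (simp add: unreturned_1)
  qed
  also have "\<dots> = (\<integral>\<^sup>+y. ennreal (V y) \<partial>\<nu>)"
    using emeasure_renewed_0 renewed_in_hist[of 0 1 0]
    by (subst nn_integral_after_renewal) auto
  finally show ?thesis using nu_V_le by simp
qed

text \<open>
  Off \<open>C\<close> the drift contracts by \<open>lam\<close>.  Each visit to \<open>C\<close> costs at most \<open>K\<close>, but it ends the excursion with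
  probability \<open>bb\<close>, so the expected number of visits at time \<open>n + 1\<close> is \<open>p (n + 1) / bb\<close>, which is
  summable.
\<close>
lemma excursion_V_Suc: "excursion_V (Suc n) \<le> ennreal lam * excursion_V n + ennreal (K / bb * p (Suc n))"
proof -
  let ?U = "unreturned (Suc n)"
  have "excursion_V (Suc n) \<le> (\<integral>\<^sup>+\<omega>. ennreal (V (X (Suc (Suc n)) \<omega>)) * indicator ?U \<omega> \<partial>M)"
    unfolding excursion_V_def using unreturned_Suc[of "Suc n"]
    by (intro nn_integral_mono) (auto simp: indicator_def)
  also have "\<dots> = (\<integral>\<^sup>+\<omega>. (\<integral>\<^sup>+y. ennreal (V y) \<partial>P (X (Suc n) \<omega>)) * indicator ?U \<omega> \<partial>M)"
    by (intro nn_integral_step unreturned_in_hist) auto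
  also have "\<dots> \<le> (\<integral>\<^sup>+\<omega>. ennreal lam * (ennreal (V (X (Suc n) \<omega>)) * indicator ?U \<omega>) 
                      + ennreal K * indicator (?U \<inter> hits (Suc n) C) \<omega> \<partial>M)"
  proof (rule nn_integral_mono)
    fix \<omega> assume \<omega>: "\<omega> \<in> space M"
    show "(\<integral>\<^sup>+y. ennreal (V y) \<partial>P (X (Suc n) \<omega>)) * indicator ?U \<omega>
        \<le> ennreal lam * (ennreal (V (X (Suc n) \<omega>)) * indicator ?U \<omega>) + ennreal K * indicator (?U \<inter> hits (Suc n) C) \<omega>"
    proof (cases "X (Suc n) \<omega> \<in> C")
      case True
      have "indicator (?U \<inter> hits (Suc n) C) \<omega> = (indicator ?U \<omega> :: ennreal)"
        using True \<omega> by (simp add: indicator_def hits_def)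
      thus ?thesis using mult_right_mono[OF drift_on_C[OF True], of "indicator ?U \<omega>"] 
        by (simp add: add_increasing)
    next
      case False
      have "0 \<le> V (X (Suc n) \<omega>)" using V_ge_1[OF X_space[OF \<omega>], of "Suc n"] by linarith
      moreover have "indicator (?U \<inter> hits (Suc n) C) \<omega> = (0 :: ennreal)"
        using False by (simp add: hits_def)
      ultimately show ?thesis 
        using mult_right_mono[OF drift_off_C[of "X (Suc n) \<omega>"], of "indicator ?U \<omega>"] False X_space[OF \<omega>] lam_pos
        by (simp add: ennreal_mult mult.assoc)
    qed
  qed
  also have "\<dots> = ennreal lam * excursion_V n + ennreal K * emeasure M (?U \<inter> hits (Suc n) C)"
    unfolding excursion_V_def by (simp add: nn_integral_add nn_integral_cmult C_sets)
  also have "ennreal K * emeasure M (?U \<inter> hits (Suc n) C) = ennreal (K / bb * p (Suc n))"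
    using K_ge_1 bb_pos by (simp add: p_Suc_eq emeasure_eq_measure ennreal_mult[symmetric])
  finally show ?thesis .
qed

lemma unreturned_le_excursion_V: "ennreal (prob (unreturned (Suc n))) \<le> excursion_V n"
proof -
  have "ennreal (prob (unreturned (Suc n))) = (\<integral>\<^sup>+\<omega>. indicator (unreturned (Suc n)) \<omega> \<partial>M)"
    by (simp add: emeasure_eq_measure)
  also have "\<dots> \<le> excursion_V n" unfolding excursion_V_def
  proof (rule nn_integral_mono)
    fix \<omega> assume "\<omega> \<in> space M"
    hence "1 \<le> ennreal (V (X (Suc n) \<omega>))" using V_ge_1[OF X_space, of \<omega> "Suc n"] by simp
    thus "indicator (unreturned (Suc n)) \<omega> \<le> ennreal (V (X (Suc n) \<omega>)) * indicator (unreturned (Suc n)) \<omega>"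
      by (auto simp: indicator_def)
  qed
  finally show ?thesis .
qed

text \<open>
  As \<open>V \<ge> 1\<close>, it suffices that the sequence \<open>excursion_V\<close> is summable; its recursion has the factor
  \<open>lam < 1\<close>, and its initial value and inhomogeneous terms add up to at most \<open>2 K / bb\<close>.
\<close>
lemma summable_unreturned: "summable (\<lambda>n. prob (unreturned (Suc n)))"
proof -
  define w where "w n = enn2real (excursion_V n)" for n
  define B where "B = K / bb"
  have B: "0 \<le> B" using K_ge_1 bb_pos by (simp add: B_def)
  have fin: "excursion_V n < \<infinity>" for n
  proof (induction n)
    case 0 thus ?case using excursion_V_0 by (simp add: le_less_trans)
  next
    case (Suc n)
    hence "ennreal lam * excursion_V n + ennreal (K / bb * p (Suc n)) < \<infinity>"
      by (simp add: ennreal_mult_less_top)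
    thus ?case using excursion_V_Suc[of n] by (rule le_less_trans[rotated])
  qed
  have w: "excursion_V n = ennreal (w n)" "0 \<le> w n" for n using fin[of n] by (auto simp: w_def)
  have w0: "w 0 \<le> B" using excursion_V_0 B by (simp add: w B_def)
  have wS: "w (Suc n) \<le> lam * w n + B * p (Suc n)" for n
    using excursion_V_Suc[of n] lam_pos B p_nonneg[of "Suc n"] w(2)[of n]
    by (simp add: w(1) B_def[symmetric] ennreal_mult[symmetric] ennreal_plus[symmetric] del: ennreal_plus)
  have sum_w: "(\<Sum>i<Suc n. w i) \<le> lam * (\<Sum>i<n. w i) + B * (1 + (\<Sum>k\<le>n. p k))" for n
  proof (induction n)
    case 0 thus ?case using w0 p_0 by simp
  next
    case (Suc n)
    have "(\<Sum>i<Suc (Suc n). w i) = (\<Sum>i<Suc n. w i) + w (Suc n)" by simp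
    also have "\<dots> \<le> lam * (\<Sum>i<n. w i) + B * (1 + (\<Sum>k\<le>n. p k)) + (lam * w n + B * p (Suc n))"
      using Suc wS[of n] by (rule add_mono)
    finally show ?case by (simp add: algebra_simps)
  qed
  have p_le: "(\<Sum>k\<le>n. p k) \<le> 1" for n
    using prob_unreturned_Suc[of n] measure_nonneg[of M "unreturned (Suc n)"] by linarith
  have "(\<Sum>i<n. w i) \<le> 2 * B / (1 - lam)" for n
  proof (induction n)
    case 0 thus ?case using B lam_less_1 by simp
  next
    case (Suc n)
    have "(\<Sum>i<Suc n. w i) \<le> lam * (\<Sum>i<n. w i) + B * (1 + (\<Sum>k\<le>n. p k))" by (rule sum_w)
    also have "\<dots> \<le> lam * (2 * B / (1 - lam)) + B * (1 + 1)"
      using Suc p_le B lam_pos by (intro add_mono mult_left_mono) auto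
    also have "\<dots> = 2 * B / (1 - lam)" using lam_less_1 by (simp add: field_simps)
    finally show ?case .
  qed
  hence "summable w" using w(2) by (intro summableI_nonneg_bounded)
  thus ?thesis
    by (rule summable_comparison_test'[where N = 0]) 
       (use unreturned_le_excursion_V in \<open>simp add: w\<close>)
qed

definition mean_return :: real where "mean_return = (\<Sum>n. prob (unreturned (Suc n)))"

lemma unreturned_sums: "(\<lambda>n. prob (unreturned (Suc n))) sums mean_return"
  unfolding mean_return_def by (rule summable_sums[OF summable_unreturned])

lemma p_sums: "p sums 1"
proof -
  have "(\<lambda>n. prob (unreturned (Suc n))) \<longlonglongrightarrow> 0" by (rule summable_LIMSEQ_zero[OF summable_unreturned])
  hence "(\<lambda>n. 1 - prob (unreturned (Suc n))) \<longlonglongrightarrow> 1 - 0" by (intro tendsto_intros)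
  thus ?thesis unfolding sums_def_le by (simp add: prob_unreturned_Suc)
qed

lemma mean_return_pos: "0 < mean_return"
  using sum_le_suminf[OF summable_unreturned, of "{0}"] by (simp add: mean_return_def unreturned_1 prob_space)

section \<open>Kac's formula\<close>
definition occupation :: "nat \<Rightarrow> 'a set \<Rightarrow> real" where
  "occupation n A = prob (unreturned (Suc n) \<inter> hits (Suc n) A)"

lemma occupation_summable: "A \<in> sets S \<Longrightarrow> summable (\<lambda>n. occupation n A)"
  by (rule summable_comparison_test'[OF summable_unreturned, of 0])
     (auto simp: occupation_def intro!: finite_measure_mono)

lemma occupation_0: 
  assumes A: "A \<in> sets S"
  shows "occupation 0 A = measure \<nu> A"
proof -
  have "ennreal (prob (renewed 0 \<inter> hits 1 A)) = ennreal (prob (hits 1 A))"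
    using renewed_0_inter[of "hits 1 A"] A by (simp add: emeasure_eq_measure)
  moreover have "unreturned (Suc 0) \<inter> hits 1 A = hits 1 A" by (auto simp: unreturned_1 hits_def)
  ultimately have "occupation 0 A = prob (renewed 0 \<inter> hits 1 A)" by (simp add: occupation_def)
  also have "\<dots> = prob (renewed 0) * measure \<nu> A"
    using prob_hits_after_renewal[of "renewed 0" 0 A] A renewed_in_hist[of 0 1 0] by simp
  finally show ?thesis using u_0 by (simp add: u_eq)
qed

lemma occupation_Suc:
  assumes A: "A \<in> sets S"
  shows "prob (unreturned (Suc n) \<inter> hits (Suc (Suc n)) A) = occupation (Suc n) A + p (Suc n) * measure \<nu> A"
proof -
  let ?H = "hits (Suc (Suc n)) A"
  have eq: "unreturned (Suc n) \<inter> ?H = (unreturned (Suc (Suc n)) \<inter> ?H) \<union> (returned (Suc n) \<inter> ?H)"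
    using unreturned_Suc[OF le_add1[of 1 n, unfolded plus_1_eq_Suc]] by blast
  have "prob ((unreturned (Suc (Suc n)) \<inter> ?H) \<union> (returned (Suc n) \<inter> ?H))
          = occupation (Suc n) A + prob (returned (Suc n) \<inter> ?H)"
    unfolding occupation_def
  proof (rule finite_measure_Union)
    show "(unreturned (Suc (Suc n)) \<inter> ?H) \<inter> (returned (Suc n) \<inter> ?H) = {}"
      using unreturned_Suc_disjoint[OF le_add1[of 1 n, unfolded plus_1_eq_Suc]] by blast
  qed (use A in auto)
  also have "prob (returned (Suc n) \<inter> ?H) = p (Suc n) * measure \<nu> A"
    using prob_hits_after_renewal[of "returned (Suc n)" "Suc n" A] A returned_in_hist[of "Suc n" "Suc n"]
    by (simp add: p_eq returned_def)
  finally show ?thesis by (simp only: eq)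
qed

text \<open>
  The sum over \<open>n\<close> of the laws of \<open>X (n + 1)\<close> restricted to \<open>unreturned (n + 1)\<close>, divided by the mean
  return time.  Writing it as an image of a product measure lets the product integral compute it.
\<close>
definition occupation_measure :: "'a measure" where
  "occupation_measure = distr (density (count_space UNIV \<Otimes>\<^sub>M M)
     (\<lambda>(n, \<omega>). ennreal (1 / mean_return) * indicator (unreturned (Suc n)) \<omega>)) S (\<lambda>(n, \<omega>). X (Suc n) \<omega>)"

lemma nn_integral_occupation_measure:
  assumes [measurable]: "f \<in> borel_measurable S"
  shows "(\<integral>\<^sup>+x. f x \<partial>occupation_measure)
    = ennreal (1 / mean_return) * (\<Sum>n. \<integral>\<^sup>+\<omega>. f (X (Suc n) \<omega>) * indicator (unreturned (Suc n)) \<omega> \<partial>M)"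
proof -
  have [measurable]: "(\<lambda>(n, \<omega>). X (Suc n) \<omega>) \<in> count_space UNIV \<Otimes>\<^sub>M M \<rightarrow>\<^sub>M S"
    by (rule measurable_pair_measure_countable1) simp_all
  have [measurable]: "(\<lambda>(n, \<omega>). ennreal (1 / mean_return) * indicator (unreturned (Suc n)) \<omega>) 
      \<in> borel_measurable (count_space UNIV \<Otimes>\<^sub>M M)"
    by (rule measurable_pair_measure_countable1) simp_all
  have "(\<integral>\<^sup>+x. f x \<partial>occupation_measure) = (\<integral>\<^sup>+z. (case z of (n, \<omega>) \<Rightarrow> ennreal (1 / mean_return) * indicator (unreturned (Suc n)) \<omega>)
            * f (case z of (n, \<omega>) \<Rightarrow> X (Suc n) \<omega>) \<partial>(count_space UNIV \<Otimes>\<^sub>M M))"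
    unfolding occupation_measure_def by (simp add: nn_integral_distr nn_integral_density)
  also have "\<dots> = (\<integral>\<^sup>+n. \<integral>\<^sup>+\<omega>. ennreal (1 / mean_return) * indicator (unreturned (Suc n)) \<omega> * f (X (Suc n) \<omega>) \<partial>M \<partial>count_space UNIV)"
    by (subst nn_integral_fst[symmetric]) simp_all
  also have "\<dots> = (\<Sum>n. \<integral>\<^sup>+\<omega>. ennreal (1 / mean_return) * (f (X (Suc n) \<omega>) * indicator (unreturned (Suc n)) \<omega>) \<partial>M)"
    by (simp add: nn_integral_count_space_nat mult_ac)
  also have "\<dots> = (\<Sum>n. ennreal (1 / mean_return) * (\<integral>\<^sup>+\<omega>. f (X (Suc n) \<omega>) * indicator (unreturned (Suc n)) \<omega> \<partial>M))"
    by (simp add: nn_integral_cmult)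
  finally show ?thesis by simp
qed

lemma sets_occupation_measure: "sets occupation_measure = sets S"
  by (simp add: occupation_measure_def)

lemma emeasure_occupation_measure:
  assumes A: "A \<in> sets S"
  shows "emeasure occupation_measure A = ennreal ((1 / mean_return) * (\<Sum>n. occupation n A))"
proof -
  have "emeasure occupation_measure A = (\<integral>\<^sup>+x. indicator A x \<partial>occupation_measure)"
    using A by (simp add: sets_occupation_measure)
  also have "\<dots> = ennreal (1 / mean_return) * (\<Sum>n. \<integral>\<^sup>+\<omega>. indicator A (X (Suc n) \<omega>) * indicator (unreturned (Suc n)) \<omega> \<partial>M)"
    using A by (intro nn_integral_occupation_measure) auto
  also have "(\<lambda>n. \<integral>\<^sup>+\<omega>. indicator A (X (Suc n) \<omega>) * indicator (unreturned (Suc n)) \<omega> \<partial>M) = (\<lambda>n. ennreal (occupation n A))"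
  proof
    fix n
    have "(\<integral>\<^sup>+\<omega>. indicator A (X (Suc n) \<omega>) * indicator (unreturned (Suc n)) \<omega> \<partial>M)
        = (\<integral>\<^sup>+\<omega>. indicator (unreturned (Suc n) \<inter> hits (Suc n) A) \<omega> \<partial>M)"
      by (intro nn_integral_cong) (auto simp: indicator_def hits_def)
    thus "(\<integral>\<^sup>+\<omega>. indicator A (X (Suc n) \<omega>) * indicator (unreturned (Suc n)) \<omega> \<partial>M) = ennreal (occupation n A)"
      using A by (simp add: occupation_def emeasure_eq_measure)
  qed
  also have "(\<Sum>n. ennreal (occupation n A)) = ennreal (\<Sum>n. occupation n A)"
    by (rule suminf_ennreal2[OF _ occupation_summable[OF A]]) (simp add: occupation_def)
  finally show ?thesis
    using mean_return_pos suminf_nonneg[OF occupation_summable[OF A]] 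
    by (simp add: ennreal_mult[symmetric] occupation_def)
qed

text \<open>
  Applying \<open>P\<close> shifts the excursion by one step.  The final step of the excursion is replaced by its
  first one, and nothing changes because the state entered after a return has law \<open>\<nu>\<close>, as has
  \<open>X 1\<close>.
\<close>
lemma stationary_occupation_measure: "stationary S P occupation_measure"
  unfolding stationary_def
proof (intro conjI ballI)
  have "occupation n (space S) = prob (unreturned (Suc n))" for n
  proof -
    have "unreturned (Suc n) \<inter> hits (Suc n) (space S) = unreturned (Suc n)"
      using X_space by (auto simp: hits_def unreturned_def)
    thus ?thesis by (simp add: occupation_def)
  qed
  hence "emeasure occupation_measure (space S) = 1"
    using mean_return_pos by (simp add: emeasure_occupation_measure mean_return_def[symmetric])
  thus "prob_space occupation_measure"
    by (intro prob_spaceI) (simp add: occupation_measure_def)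
  show "sets occupation_measure = sets S" by (rule sets_occupation_measure)
  fix A assume A: "A \<in> sets S"
  note A[measurable]
  have mP: "(\<lambda>x. emeasure (P x) A) \<in> borel_measurable S"
    using measurable_compose[OF measurable_P measurable_emeasure_subprob_algebra[OF A]] .
  have "(\<integral>\<^sup>+x. emeasure (P x) A \<partial>occupation_measure) = ennreal (1 / mean_return) * 
      (\<Sum>n. \<integral>\<^sup>+\<omega>. emeasure (P (X (Suc n) \<omega>)) A * indicator (unreturned (Suc n)) \<omega> \<partial>M)"
    by (rule nn_integral_occupation_measure[OF mP])
  also have "(\<lambda>n. \<integral>\<^sup>+\<omega>. emeasure (P (X (Suc n) \<omega>)) A * indicator (unreturned (Suc n)) \<omega> \<partial>M) 
      = (\<lambda>n. ennreal (occupation (Suc n) A + p (Suc n) * measure \<nu> A))"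
  proof
    fix n
    have "(\<integral>\<^sup>+\<omega>. emeasure (P (X (Suc n) \<omega>)) A * indicator (unreturned (Suc n)) \<omega> \<partial>M)
      = (\<integral>\<^sup>+\<omega>. (\<integral>\<^sup>+y. indicator A y \<partial>P (X (Suc n) \<omega>)) * indicator (unreturned (Suc n)) \<omega> \<partial>M)"
      using A X_space by (intro nn_integral_cong) (simp add: sets_P)
    also have "\<dots> = (\<integral>\<^sup>+\<omega>. indicator A (X (Suc (Suc n)) \<omega>) * indicator (unreturned (Suc n)) \<omega> \<partial>M)"
      using A by (intro nn_integral_step[symmetric] unreturned_in_hist) auto
    also have "\<dots> = (\<integral>\<^sup>+\<omega>. indicator (unreturned (Suc n) \<inter> hits (Suc (Suc n)) A) \<omega> \<partial>M)"
      by (intro nn_integral_cong) (auto simp: indicator_def hits_def)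
    also have "\<dots> = ennreal (prob (unreturned (Suc n) \<inter> hits (Suc (Suc n)) A))"
      using A by (simp add: emeasure_eq_measure)
    finally show "(\<integral>\<^sup>+\<omega>. emeasure (P (X (Suc n) \<omega>)) A * indicator (unreturned (Suc n)) \<omega> \<partial>M)
        = ennreal (occupation (Suc n) A + p (Suc n) * measure \<nu> A)"
      by (simp only: occupation_Suc[OF A])
  qed
  also have "(\<Sum>n. ennreal (occupation (Suc n) A + p (Suc n) * measure \<nu> A)) = ennreal (\<Sum>n. occupation n A)"
  proof -
    have "(\<lambda>n. p (Suc n)) sums (1 - p 0)" using p_sums by (simp only: sums_Suc_iff) (simp add: p_0)
    moreover have "(\<lambda>n. occupation (Suc n) A) sums ((\<Sum>n. occupation n A) - occupation 0 A)"
      using summable_sums[OF occupation_summable[OF A]] 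
        sums_Suc_iff[of "\<lambda>n. occupation n A" "(\<Sum>n. occupation n A) - occupation 0 A"] by simp
    ultimately have "(\<lambda>n. occupation (Suc n) A + p (Suc n) * measure \<nu> A) 
        sums ((\<Sum>n. occupation n A) - occupation 0 A + (1 - p 0) * measure \<nu> A)"
      by (intro sums_add sums_mult2)
    hence *: "(\<lambda>n. occupation (Suc n) A + p (Suc n) * measure \<nu> A) sums (\<Sum>n. occupation n A)"
      by (simp add: p_0 occupation_0[OF A])
    have "(\<Sum>n. ennreal (occupation (Suc n) A + p (Suc n) * measure \<nu> A)) 
        = ennreal (\<Sum>n. occupation (Suc n) A + p (Suc n) * measure \<nu> A)"
      by (rule suminf_ennreal2[OF _ sums_summable[OF *]]) (simp add: occupation_def p_nonneg)
    thus ?thesis using * by (simp add: sums_iff)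
  qed
  finally show "emeasure occupation_measure A = (\<integral>\<^sup>+x. emeasure (P x) A \<partial>occupation_measure)"
    using mean_return_pos suminf_nonneg[OF occupation_summable[OF A]] 
    by (simp add: emeasure_occupation_measure[OF A] ennreal_mult[symmetric] occupation_def)
qed

text \<open>
  Every visit to \<open>C\<close> during the excursion ends it with probability \<open>bb\<close>, so \<open>1 / bb\<close> visits are expected.
\<close>
lemma kac_formula: "bb * measure \<pi> C = 1 / mean_return"
proof -
  have \<pi>: "\<pi> = occupation_measure" 
    by (rule stationary_unique[OF stationary_occupation_measure, symmetric])
  have "measure \<pi> C = (1 / mean_return) * (\<Sum>n. occupation n C)"
    unfolding \<pi> measure_def emeasure_occupation_measure[OF C_sets]
    using mean_return_pos suminf_nonneg[OF occupation_summable[OF C_sets]] by (simp add: occupation_def)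
  moreover have "bb * (\<Sum>n. occupation n C) = (\<Sum>n. p (Suc n))"
    using suminf_mult[OF occupation_summable[OF C_sets], of bb] by (simp add: p_Suc_eq occupation_def)
  moreover have "(\<lambda>n. p (Suc n)) sums (1 - p 0)" using p_sums by (simp only: sums_Suc_iff) (simp add: p_0)
  ultimately show ?thesis by (simp add: sums_iff p_0)
qed

end

section \<open>Convergence of the renewal sequence of the split chain\<close>
lemma L_bound_pos:
  assumes "0 < bb" "0 < s" "(1 - bb) * s powr (1 + alpha1 R L bb) < 1"
  shows "0 < L_bound R L bb b s"
proof -
  have "0 < bb * s / (1 - (1 - bb) * s powr (1 + alpha1 R L bb))" using assms by simp
  thus ?thesis by (auto simp: L_bound_def less_max_iff_disj)
qed

lemma return_gf_le_imp_suminf_le: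
  assumes s: "0 \<le> s" and l: "0 \<le> l" and p0: "return_prob M Y 0 = 0"
    and le: "return_gf M Y s \<le> ennreal l"
  shows "summable (\<lambda>n. return_prob M Y n * s ^ n)" "(\<Sum>n. return_prob M Y n * s ^ n) \<le> l"
proof -
  define f where "f = (\<lambda>n. return_prob M Y n * s ^ n)"
  have f: "0 \<le> f n" for n using s by (simp add: f_def return_prob_def)
  have gf: "return_gf M Y s = (\<Sum>n. ennreal (f (Suc n)))" by (simp add: return_gf_def f_def)
  hence "(\<Sum>n. ennreal (f (Suc n))) \<noteq> top" using le by (metis ennreal_less_top leD top.not_eq_extremum)
  hence sm': "summable (\<lambda>n. f (Suc n))" using f by (intro summable_suminf_not_top)
  hence sm: "summable f" by (simp only: summable_Suc_iff)
  have "ennreal (\<Sum>n. f (Suc n)) \<le> ennreal l"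
    using le f sm' by (simp only: gf suminf_ennreal2)
  hence "(\<Sum>n. f (Suc n)) \<le> l" using l by simp
  moreover have "(\<Sum>n. f (Suc n)) = suminf f" using suminf_split_head[OF sm] by (simp add: f_def p0)
  ultimately show "summable (\<lambda>n. return_prob M Y n * s ^ n)" "(\<Sum>n. return_prob M Y n * s ^ n) \<le> l"
    using sm by (auto simp: f_def)
qed

theorem theorem3p1:
  fixes S :: "'a measure" and P :: "'a \<Rightarrow> 'a measure" and \<pi> :: "'a measure"
    and C :: "'a set" and bb :: real and \<nu> :: "'a measure"
    and V :: "'a \<Rightarrow> real" and lam K b :: real
    and M :: "'w measure" and X :: "nat \<Rightarrow> 'w \<Rightarrow> 'a" and Y :: "nat \<Rightarrow> 'w \<Rightarrow> nat" and a :: 'a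
    and R L \<alpha> u_inf r :: real
  assumes chain: "drift_chain S P \<pi> C bb \<nu> V lam K b"
    and a: "a \<in> C"
    and split: "split_chain M S P C bb \<nu> X Y a 1"
    and R: "R = 1 / lam"
    and L: "L = K * R"
    and b1: "return_prob M Y 1 \<ge> b"
    and gf: "\<And>s. 1 \<le> s \<Longrightarrow> s \<le> R \<Longrightarrow> (1 - bb) * s powr (1 + alpha1 R L bb) < 1 \<Longrightarrow>
               return_gf M Y s \<le> ennreal (L_bound R L bb b s)"
    and \<alpha>: "\<alpha> = (1 / (bb * measure \<pi> C) - 1) / (1 - b)"
    and u_inf: "u_inf = lim (renewal_prob M Y)"
    and r: "1 < r" "ereal r < r0_bar R L bb b \<alpha>"
  shows "(\<forall>z\<in>sphere 0 r. summable (\<lambda>n. complex_of_real (renewal_prob M Y n - u_inf) * z ^ n)) \<and>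
         (SUP z\<in>sphere 0 r. ereal (cmod (\<Sum>n. complex_of_real (renewal_prob M Y n - u_inf) * z ^ n)))
           \<le> ereal (K0_bar R L bb b (measure \<pi> C) \<alpha> r)"
proof -
  interpret split_chain M S P C bb \<nu> X Y a 1 by (rule split)
  interpret drift_chain S P \<pi> C bb \<nu> V lam K b by (rule chain)
  interpret atomic_split_chain S P \<pi> C bb \<nu> V lam K b M X Y a
    by unfold_locales (rule a)
  let ?u = "renewal_prob M Y" and ?p = "return_prob M Y"
  define m where "m = mean_return"
  have \<pi>C: "bb * measure \<pi> C = 1 / m" unfolding m_def by (rule kac_formula)
  have b: "0 < b" "b < 1" using b_pos b1 p_1_less_1 by auto
  have R1: "1 < R" using R lam_pos lam_less_1 by simp
  have a1: "0 \<le> alpha1 R L bb"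
  proof -
    have "(L - bb * R) / ((1 - bb) * R) = (K - bb) / (1 - bb)"
      using R1 by (simp add: L left_diff_distrib[symmetric])
    moreover have "1 \<le> (K - bb) / (1 - bb)" using K_ge_1 bb_less_1 by simp
    ultimately show ?thesis using R1 by (simp add: alpha1_def)
  qed
  have gf': "summable (\<lambda>n. ?p n * s ^ n) \<and> (\<Sum>n. ?p n * s ^ n) \<le> L_bound R L bb b s"
    if s: "1 \<le> s" "s \<le> R" "(1 - bb) * s powr (1 + alpha1 R L bb) < 1" for s
    using return_gf_le_imp_suminf_le[OF _ _ p_0 gf[OF s]] L_bound_pos[OF bb_pos _ s(3), of b] s(1) by simp
  have \<alpha>_eq: "\<alpha> = (m - 1) / (1 - b)" by (simp add: \<alpha> \<pi>C)
  have tail_sums: "(\<lambda>n. 1 - (\<Sum>k\<le>n. ?p k)) sums m"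
    using unreturned_sums by (simp add: prob_unreturned_Suc m_def)
  have kendall_summable: "summable (\<lambda>n. complex_of_real (?u n - 1 / m) * z ^ n)" if "cmod z = r" for z
    by (rule kendall_convex_minorant_bound(1)[OF p_0 p_nonneg p_sums b1 p_1_less_1 tail_sums u_0
      renewal_equation b bb_pos bb_less_1 R1 a1 gf' \<alpha>_eq r that]; assumption)
  have kendall_bound: "cmod (\<Sum>n. complex_of_real (?u n - 1 / m) * z ^ n)
           \<le> (1 / m) * (r powr kappa R L bb b \<alpha> r - 1)
               / ((r - 1) * (D b \<alpha> / \<alpha> - r powr kappa R L bb b \<alpha> r + 1))" if "cmod z = r" for z
    by (rule kendall_convex_minorant_bound(2)[OF p_0 p_nonneg p_sums b1 p_1_less_1 tail_sums u_0
      renewal_equation b bb_pos bb_less_1 R1 a1 gf' \<alpha>_eq r that]; assumption)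
  \<comment> \<open>The terms of a convergent series at a radius \<open>r > 1\<close> dominate the differences \<open>u n - 1 / m\<close>.\<close>
  have "?u \<longlonglongrightarrow> 1 / m"
  proof -
    have "summable (\<lambda>n. of_real (?u n - 1 / m) * (of_real r :: complex) ^ n)"
      using r(1) by (intro kendall_summable) simp
    hence "(\<lambda>n. of_real (?u n - 1 / m) * (of_real r :: complex) ^ n) \<longlonglongrightarrow> 0" by (rule summable_LIMSEQ_zero)
    hence "(\<lambda>n. cmod (of_real (?u n - 1 / m) * (of_real r :: complex) ^ n)) \<longlonglongrightarrow> 0" by (rule tendsto_norm_zero)
    hence "(\<lambda>n. \<bar>?u n - 1 / m\<bar> * r ^ n) \<longlonglongrightarrow> 0"
      using r(1) by (simp add: norm_mult norm_power del: of_real_diff)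
    hence "(\<lambda>n. ?u n - 1 / m) \<longlonglongrightarrow> 0"
    proof (rule Lim_null_comparison[rotated])
      show "\<forall>\<^sub>F n in sequentially. norm (?u n - 1 / m) \<le> \<bar>?u n - 1 / m\<bar> * r ^ n"
      proof (rule always_eventually, rule allI)
        fix n
        have "\<bar>?u n - 1 / m\<bar> * 1 \<le> \<bar>?u n - 1 / m\<bar> * r ^ n"
          using r(1) by (intro mult_left_mono) (auto intro: one_le_power)
        thus "norm (?u n - 1 / m) \<le> \<bar>?u n - 1 / m\<bar> * r ^ n" by simp
      qed
    qed
    thus ?thesis by (simp only: LIM_zero_iff)
  qed
  hence u_inf_eq: "u_inf = 1 / m" unfolding u_inf by (rule limI)
  have K0: "K0_bar R L bb b (measure \<pi> C) \<alpha> r = (1 / m) * (r powr kappa R L bb b \<alpha> r - 1)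
     / ((r - 1) * (D b \<alpha> / \<alpha> - r powr kappa R L bb b \<alpha> r + 1))"
    by (simp only: K0_bar_def \<pi>C)
  show ?thesis
  proof
    show "\<forall>z\<in>sphere 0 r. summable (\<lambda>n. complex_of_real (?u n - u_inf) * z ^ n)"
      unfolding u_inf_eq using kendall_summable by simp
    show "(SUP z\<in>sphere 0 r. ereal (cmod (\<Sum>n. complex_of_real (?u n - u_inf) * z ^ n)))
           \<le> ereal (K0_bar R L bb b (measure \<pi> C) \<alpha> r)"
      unfolding u_inf_eq K0
    proof (rule SUP_least)
      fix z :: complex assume "z \<in> sphere 0 r"
      hence "cmod z = r" by simp
      from kendall_bound[OF this] 
      show "ereal (cmod (\<Sum>n. complex_of_real (?u n - 1 / m) * z ^ n)) \<le> ereal ((1 / m) * (r powr kappa R L bb b \<alpha> r - 1)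
        / ((r - 1) * (D b \<alpha> / \<alpha> - r powr kappa R L bb b \<alpha> r + 1)))" by (simp only: ereal_less_eq)
    qed
  qed
qed

end
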